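(* The Fourier transform $\mathcal F$ maps $J(H^2)$ onto $$\{g\in L^2([-\pi,\pi]):\ \operatorname{supp}g\subseteq[0,\pi]\}.$$ Moreover, for every $f\in H^2$, $\|\mathcal F(Jf)\|_{L^2([-\pi,\pi])}=\|f\|_{H^2}$. Finally, the orthogonal projection $P:\ell^2(\mathbb Z)\to J(H^2)$ (the Szeg\H{o} projection) is given by $$Pf=f\ast C=\mathcal F^{-1}\big(\chi_{[0,\pi]}\,\mathcal Ff\big),\qquad f\in\ell^2(\mathbb Z),$$ where $\chi_{[0,\pi]}$ is the characteristic function of $[0,\pi]$, $C$ is the discrete Cauchy kernel restricted to $\mathbb Z$, and $(f\ast C)(m)=\sum_{j\in\mathbb Z}f(j)C(m-j)$.
   Context: Lattice points $(m,n)\in\mathbb Z^2$ are identified with $m+in\in\mathbb C$. Let $\mathbb Z^2_+=\{m+in: m,n\in\mathbb Z,\ n\geqslant 0\}$. A function $f:\mathbb Z^2_+\to\mathbb C$ is discrete holomorphic, written $f\in\operatorname{Hol}(\mathbb Z^2_+)$, if $f(z)+i f(z+1)-f(z+1+i)-i f(z+i)=0$ for every $z\in\mathbb Z^2_+$. $H^2=H^2(\mathbb Z^2_+)=\{f\in\operatorname{Hol}(\mathbb Z^2_+): \|f\|_{H^2}:=\sup_{n\geqslant 0}\|f(\cdot+in)\|_{\ell^2(\mathbb Z)}<\infty\}$. The restriction operator is $J:H^2\to\ell^2(\mathbb Z)$, $Jf=(f(m))_{m\in\mathbb Z}$. The Fourier transform $\mathcal F:\ell^2(\mathbb Z)\to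 L^2([-\pi,\pi])$ (Lebesgue measure, unnormalized) is $(\mathcal Ff)(t)=\frac1{\sqrt{2\pi}}\sum_{m\in\mathbb Z}f(m)e^{-imt}$, with inverse $(\mathcal F^{-1}g)(m)=\frac1{\sqrt{2\pi}}\int_{-\pi}^\pi g(t)e^{imt}\,dt$. For $g\in L^2([-\pi,\pi])$, $\operatorname{supp}g\subseteq[0,\pi]$ means $g=0$ a.e. on $(-\pi,0)$. The discrete Cauchy kernel on $\mathbb Z$ is $C(m)=\frac1{2\pi}\int_0^\pi e^{imt}\,dt$, $m\in\mathbb Z$. *)

theory Defs
  imports "HOL-Analysis.Analysis"
begin

definition l2 :: "(int \<Rightarrow> complex) set" where
  "l2 = {f. (\<lambda>m. (cmod (f m))\<^sup>2) summable_on UNIV}"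

definition l2_norm :: "(int \<Rightarrow> complex) \<Rightarrow> real" where
  "l2_norm f = sqrt (\<Sum>\<^sub>\<infinity>m. (cmod (f m))\<^sup>2)"

definition l2_inner :: "(int \<Rightarrow> complex) \<Rightarrow> (int \<Rightarrow> complex) \<Rightarrow> complex" where
  "l2_inner f g = (\<Sum>\<^sub>\<infinity>m. f m * cnj (g m))"

text \<open>
  The lattice half-plane of points m + i n with n nonnegative is the type
  \<^typ>\<open>int \<times> nat\<close>; the pair (m, n) stands for m + i n.
\<close>

definition discrete_holomorphic :: "(int \<times> nat \<Rightarrow> complex) \<Rightarrow> bool" where
  "discrete_holomorphic f \<longleftrightarrow>
     (\<forall>m n. f (m, n) + \<i> * f (m + 1, n) - f (m + 1, n + 1) - \<i> * f (m, n + 1) = 0)"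

definition row :: "(int \<times> nat \<Rightarrow> complex) \<Rightarrow> nat \<Rightarrow> int \<Rightarrow> complex" where
  "row f n = (\<lambda>m. f (m, n))"

text \<open>
  Membership of every row in \<^const>\<open>l2\<close> has to be required separately, because
  \<^const>\<open>l2_norm\<close> is 0 for a sequence that is not square-summable.
\<close>

definition H2 :: "(int \<times> nat \<Rightarrow> complex) set" where
  "H2 = {f. discrete_holomorphic f \<and> (\<forall>n. row f n \<in> l2) \<and>
            bdd_above (range (\<lambda>n. l2_norm (row f n)))}"

definition H2_norm :: "(int \<times> nat \<Rightarrow> complex) \<Rightarrow> real" where
  "H2_norm f = (SUP n. l2_norm (row f n))"

definition J :: "(int \<times> nat \<Rightarrow> complex) \<Rightarrow> int \<Rightarrow> complex" where
  "J f = (\<lambda>m. f (m, 0))"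

text \<open>
  Elements of \<open>L2\<close> are equivalence classes of square-integrable functions on the
  interval from \<open>-pi\<close> to \<open>pi\<close> modulo equality almost everywhere there. The values of a
  representative outside the interval are irrelevant.
\<close>

abbreviation circ_measure :: "real measure" where
  "circ_measure \<equiv> lebesgue_on {-pi..pi}"

definition sq_integrable :: "(real \<Rightarrow> complex) set" where
  "sq_integrable = {g. g \<in> borel_measurable circ_measure \<and>
                       integrable circ_measure (\<lambda>t. (cmod (g t))\<^sup>2)}"

definition sq_norm :: "(real \<Rightarrow> complex) \<Rightarrow> real" where
  "sq_norm g = sqrt (LINT t|circ_measure. (cmod (g t))\<^sup>2)"

definition ae_rel :: "((real \<Rightarrow> complex) \<times> (real \<Rightarrow> complex)) set" where
  "ae_rel = {(g, h). g \<in> sq_integrable \<and> h \<in> sq_integrable \<and> (AE t in circ_measure. g t = h t)}"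

definition L2 :: "(real \<Rightarrow> complex) set set" where
  "L2 = sq_integrable // ae_rel"

text \<open>
  Here and in \<open>inv_fourier\<close> below, \<^const>\<open>the_elem\<close> picks the value shared by all
  representatives of a class.
\<close>

definition L2_norm :: "(real \<Rightarrow> complex) set \<Rightarrow> real" where
  "L2_norm G = the_elem (sq_norm ` G)"

definition supp_upper :: "(real \<Rightarrow> complex) set \<Rightarrow> bool" where
  "supp_upper G \<longleftrightarrow> (\<forall>g\<in>G. AE t in circ_measure. t \<in> {-pi<..<0} \<longrightarrow> g t = 0)"

definition chi_mult :: "(real \<Rightarrow> complex) set \<Rightarrow> (real \<Rightarrow> complex) set" where
  "chi_mult G = (\<Union>g\<in>G. ae_rel `` {\<lambda>t. indicator {0..pi} t * g t})"

definition fourier_sum :: "(int \<Rightarrow> complex) \<Rightarrow> int set \<Rightarrow> real \<Rightarrow> complex" where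
  "fourier_sum f A t = 1 / sqrt (2 * pi) * (\<Sum>m\<in>A. f m * cis (- (of_int m * t)))"

text \<open>
  The Fourier series of a square-summable sequence is understood as an unconditional sum in
  the mean-square sense: the class of all mean-square limits of its finite partial sums.
\<close>

definition fourier :: "(int \<Rightarrow> complex) \<Rightarrow> (real \<Rightarrow> complex) set" where
  "fourier f = {g \<in> sq_integrable.
     ((\<lambda>A. sq_norm (\<lambda>t. fourier_sum f A t - g t)) \<longlongrightarrow> 0) (finite_subsets_at_top UNIV)}"

definition inv_fourier :: "(real \<Rightarrow> complex) set \<Rightarrow> int \<Rightarrow> complex" where
  "inv_fourier G m =
     the_elem ((\<lambda>g. 1 / sqrt (2 * pi) * (LINT t|circ_measure. g t * cis (of_int m * t))) ` G)"

definition cauchy_kernel :: "int \<Rightarrow> complex" where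
  "cauchy_kernel m = 1 / (2 * pi) * (LINT t|lebesgue_on {0..pi}. cis (of_int m * t))"

definition conv :: "(int \<Rightarrow> complex) \<Rightarrow> (int \<Rightarrow> complex) \<Rightarrow> int \<Rightarrow> complex" where
  "conv f g m = (\<Sum>\<^sub>\<infinity>j. f j * g (m - j))"

text \<open>
  The point of \<open>S\<close> whose difference from \<open>f\<close> is orthogonal to \<open>S\<close>; it exists and is
  unique for every \<open>f\<close> in \<^const>\<open>l2\<close> if \<open>S\<close> is a closed subspace of \<^const>\<open>l2\<close>.
\<close>

definition orth_proj :: "(int \<Rightarrow> complex) set \<Rightarrow> (int \<Rightarrow> complex) \<Rightarrow> int \<Rightarrow> complex" where
  "orth_proj S f = (THE g. g \<in> S \<and> (\<forall>h\<in>S. l2_inner (\<lambda>m. f m - g m) h = 0))"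

end

theory Submission
  imports Defs
begin

text \<open>
  On the Fourier side, discrete holomorphy says that the transforms of consecutive rows satisfy
  \<open>(1 + i e^{it}) g_n = (e^{it} + i) g_{n+1}\<close>, and
  \<open>|1 + i e^{it}|^2 = 2 (1 - sin t)\<close>, \<open>|e^{it} + i|^2 = 2 (1 + sin t)\<close>. So passing to the next row
  shrinks the transform pointwise on \<open>[0, pi]\<close>, and makes it grow at least like
  \<open>(1 - sin t)^n\<close> on \<open>(-pi, 0)\<close>. Bounded row norms therefore force the transform of
  the bottom row to live on \<open>[0, pi]\<close>, where the bottom row has the largest norm; conversely
  any such transform is extended upwards by powers of the multiplier. Everything else is
  Parseval's identity, with multiplication by the characteristic function of \<open>[0, pi]\<close> as
  the orthogonal projection.
\<close>

subsection \<open>Mean-square integrable functions\<close>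

text \<open>The transform is handled from the other side. \<open>fourier\<close> yields classes of
  functions, whereas \<open>fcoeff\<close> is a plain map from functions to sequences; once it is
  known to be onto \<open>l2\<close>, injective modulo null sets and isometric, every claim about a
  sequence f becomes one about a single g with \<open>fcoeff g = f\<close>. Surjectivity is
  completeness of L2, injectivity is density of trigonometric polynomials, and Parseval's identity
  rests on both.

  The growth argument has no uniform rate: as t approaches 0 or -pi, the quotient of the two
  multipliers has modulus tending to 1, and at -pi/2 its denominator vanishes. Division is therefore
  avoided, and Bernoulli's inequality gives n (- sin t) as a lower bound for (1 - sin t)^n. The
  integral over (-pi, 0) of - sin t times the squared modulus of the bottom transform, multiplied by
  n, then stays below a fixed bound for all n, so it is 0.\<close>

definition circ_inner :: "(real \<Rightarrow> complex) \<Rightarrow> (real \<Rightarrow> complex) \<Rightarrow> complex" where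
  "circ_inner g h = (LINT t|circ_measure. g t * cnj (h t))"

text \<open>\<open>inv_fourier\<close> on a representative. The exponent has the sign opposite to
  that in \<open>fourier_sum\<close>, so that the coefficients of a partial sum are read off and
  multiplication by \<open>cis t\<close> becomes the shift from m to m + 1.\<close>

definition fcoeff :: "(real \<Rightarrow> complex) \<Rightarrow> int \<Rightarrow> complex" where
  "fcoeff g m = 1 / sqrt (2 * pi) * (LINT t|circ_measure. g t * cis (of_int m * t))"

lemma finite_circ_measure: "finite_measure circ_measure"
  by (metis cbox_interval finite_measure_lebesgue_on lmeasurable_cbox)

lemma measurable_cis_lebesgue [measurable]: "(\<lambda>t. cis (a * t)) \<in> borel_measurable circ_measure"
  by (intro continuous_imp_measurable_on_sets_lebesgue continuous_intros) auto

lemma sq_integrable_measurable [measurable_dest]: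
  "g \<in> sq_integrable \<Longrightarrow> g \<in> borel_measurable circ_measure"
  by (simp add: sq_integrable_def)

lemma sq_integrable_integrable_sq:
  "g \<in> sq_integrable \<Longrightarrow> integrable circ_measure (\<lambda>t. (cmod (g t))\<^sup>2)"
  by (simp add: sq_integrable_def)

lemma sq_integrable_mult_bounded:
  assumes g: "g \<in> sq_integrable" and [measurable]: "h \<in> borel_measurable circ_measure"
    and B: "\<And>t. cmod (h t) \<le> B"
  shows "(\<lambda>t. h t * g t) \<in> sq_integrable"
proof -
  note [measurable] = sq_integrable_measurable[OF g]
  have "integrable circ_measure (\<lambda>t. (cmod (h t * g t))\<^sup>2)"
  proof (rule Bochner_Integration.integrable_bound)
    show "integrable circ_measure (\<lambda>t. B\<^sup>2 * (cmod (g t))\<^sup>2)"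
      using sq_integrable_integrable_sq[OF g] by simp
    show "AE t in circ_measure. norm ((cmod (h t * g t))\<^sup>2) \<le> norm (B\<^sup>2 * (cmod (g t))\<^sup>2)"
      using B by (auto simp: norm_mult power_mult_distrib intro!: mult_right_mono power_mono)
  qed measurable
  then show ?thesis
    by (simp add: sq_integrable_def)
qed

lemma sq_integrable_bounded:
  assumes [measurable]: "h \<in> borel_measurable circ_measure" and "\<And>t. cmod (h t) \<le> B"
  shows "h \<in> sq_integrable"
proof -
  have "(\<lambda>t. 1) \<in> sq_integrable"
    using finite_measure.integrable_const[OF finite_circ_measure]
    by (simp add: sq_integrable_def)
  from sq_integrable_mult_bounded[OF this assms] show ?thesis by simp
qed

lemma sq_integrable_cmult: "g \<in> sq_integrable \<Longrightarrow> (\<lambda>t. c * g t) \<in> sq_integrable"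
  by (rule sq_integrable_mult_bounded[where B="cmod c"]) auto

lemma sq_integrable_cis: "(\<lambda>t. cis (a * t)) \<in> sq_integrable"
  by (rule sq_integrable_bounded[where B=1]) auto

lemma sq_integrable_cnj: "g \<in> sq_integrable \<Longrightarrow> (\<lambda>t. cnj (g t)) \<in> sq_integrable"
  using borel_measurable_continuous_on[of cnj g circ_measure] continuous_on_cnj[of UNIV "\<lambda>z. z"]
  by (auto simp: sq_integrable_def)

lemma sq_integrable_add:
  assumes g: "g \<in> sq_integrable" and h: "h \<in> sq_integrable"
  shows "(\<lambda>t. g t + h t) \<in> sq_integrable"
proof -
  note [measurable] = sq_integrable_measurable[OF g] sq_integrable_measurable[OF h]
  have "integrable circ_measure (\<lambda>t. (cmod (g t + h t))\<^sup>2)"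
  proof (rule Bochner_Integration.integrable_bound)
    show "integrable circ_measure (\<lambda>t. 2 * (cmod (g t))\<^sup>2 + 2 * (cmod (h t))\<^sup>2)"
      using g h by (simp add: sq_integrable_integrable_sq)
    have "(cmod (g t + h t))\<^sup>2 \<le> 2 * (cmod (g t))\<^sup>2 + 2 * (cmod (h t))\<^sup>2" for t
    proof -
      have "(cmod (g t + h t))\<^sup>2 \<le> (cmod (g t) + cmod (h t))\<^sup>2"
        by (intro power_mono norm_triangle_ineq) auto
      also have "\<dots> \<le> 2 * (cmod (g t))\<^sup>2 + 2 * (cmod (h t))\<^sup>2"
        using sum_squares_bound[of "cmod (g t)" "cmod (h t)"] by (simp add: power2_sum)
      finally show ?thesis .
    qed
    then show "AE t in circ_measure. norm ((cmod (g t + h t))\<^sup>2)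
        \<le> norm (2 * (cmod (g t))\<^sup>2 + 2 * (cmod (h t))\<^sup>2)"
      by auto
  qed measurable
  then show ?thesis
    by (simp add: sq_integrable_def)
qed

lemma sq_integrable_diff:
  assumes "g \<in> sq_integrable" and "h \<in> sq_integrable"
  shows "(\<lambda>t. g t - h t) \<in> sq_integrable"
  using sq_integrable_add[OF assms(1) sq_integrable_cmult[OF assms(2), of "-1"]] by simp

lemma sq_integrable_sum:
  assumes "\<And>i. i \<in> A \<Longrightarrow> g i \<in> sq_integrable"
  shows "(\<lambda>t. \<Sum>i\<in>A. g i t) \<in> sq_integrable"
  using assms
proof (induction A rule: infinite_finite_induct)
  case (insert a A)
  then show ?case by (auto intro: sq_integrable_add)
qed (auto intro: sq_integrable_bounded[where B=0])

lemma integrable_mult_sq_integrable: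
  assumes g: "g \<in> sq_integrable" and h: "h \<in> sq_integrable"
  shows "integrable circ_measure (\<lambda>t. g t * h t)"
proof (rule Bochner_Integration.integrable_bound)
  show "integrable circ_measure (\<lambda>t. (cmod (g t))\<^sup>2 + (cmod (h t))\<^sup>2)"
    using g h by (simp add: sq_integrable_integrable_sq)
  have "cmod (g t * h t) \<le> (cmod (g t))\<^sup>2 + (cmod (h t))\<^sup>2" for t
    using sum_squares_bound[of "cmod (g t)" "cmod (h t)"]
      mult_nonneg_nonneg[OF norm_ge_zero[of "g t"] norm_ge_zero[of "h t"]]
    unfolding norm_mult by linarith
  then show "AE t in circ_measure. norm (g t * h t) \<le> norm ((cmod (g t))\<^sup>2 + (cmod (h t))\<^sup>2)"
    by auto
  show "(\<lambda>t. g t * h t) \<in> borel_measurable circ_measure"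
    using g h by measurable
qed

lemma integrable_sq_integrable: "g \<in> sq_integrable \<Longrightarrow> integrable circ_measure g"
  using integrable_mult_sq_integrable[OF _ sq_integrable_cis[of 0]] by simp

lemma sq_norm_nonneg [simp]: "sq_norm g \<ge> 0"
  by (simp add: sq_norm_def)

lemma sq_norm_power2: "(sq_norm g)\<^sup>2 = (LINT t|circ_measure. (cmod (g t))\<^sup>2)"
  by (simp add: sq_norm_def)

lemma sq_norm_cong_AE:
  assumes g: "g \<in> borel_measurable circ_measure" and h: "h \<in> borel_measurable circ_measure"
    and ae: "AE t in circ_measure. g t = h t"
  shows "sq_norm g = sq_norm h"
  unfolding sq_norm_def
  using ae g h by (intro arg_cong[where f=sqrt] integral_cong_AE) auto

lemma nn_integral_sq_norm:
  assumes "g \<in> sq_integrable"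
  shows "(\<integral>\<^sup>+t. ennreal ((cmod (g t))\<^sup>2) \<partial>circ_measure) = ennreal ((sq_norm g)\<^sup>2)"
  unfolding sq_norm_power2
  by (intro nn_integral_eq_integral sq_integrable_integrable_sq assms) auto

text \<open>Keeping the moduli inside the integral makes the bound serve twice: for inner products,
  and, with second factor 1, for estimating L1 norms by mean-square norms.\<close>

lemma Cauchy_Schwarz_sq_norm:
  assumes g: "g \<in> sq_integrable" and h: "h \<in> sq_integrable"
  shows "(LINT t|circ_measure. cmod (g t) * cmod (h t)) \<le> sq_norm g * sq_norm h"
proof -
  note [measurable] = sq_integrable_measurable[OF g] sq_integrable_measurable[OF h]
  let ?I = "LINT t|circ_measure. cmod (g t) * cmod (h t)"
  have int: "integrable circ_measure (\<lambda>t. cmod (g t) * cmod (h t))"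
    using integrable_norm[OF integrable_mult_sq_integrable[OF g h]] by (simp add: norm_mult)
  have I: "(\<integral>\<^sup>+t. ennreal (cmod (g t)) * ennreal (cmod (h t)) \<partial>circ_measure) = ennreal ?I"
    using nn_integral_eq_integral[OF int] by (simp add: ennreal_mult)
  have "(ennreal ?I)\<^sup>2 \<le> ennreal ((sq_norm g)\<^sup>2) * ennreal ((sq_norm h)\<^sup>2)"
    using Cauchy_Schwarz_nn_integral[of "\<lambda>t. ennreal (cmod (g t))" circ_measure "\<lambda>t. ennreal (cmod (h t))"]
    by (simp add: I nn_integral_sq_norm[OF g, symmetric] nn_integral_sq_norm[OF h, symmetric] ennreal_power)
  then have "?I\<^sup>2 \<le> (sq_norm g * sq_norm h)\<^sup>2"
    by (simp add: ennreal_power power_mult_distrib flip: ennreal_mult)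
  then show ?thesis
    by (rule power2_le_imp_le) simp
qed

lemma cmod_circ_inner_le:
  assumes g: "g \<in> sq_integrable" and h: "h \<in> sq_integrable"
  shows "cmod (circ_inner g h) \<le> sq_norm g * sq_norm h"
proof -
  have "cmod (circ_inner g h) \<le> (LINT t|circ_measure. cmod (g t * cnj (h t)))"
    unfolding circ_inner_def by (rule integral_norm_bound)
  also have "\<dots> \<le> sq_norm g * sq_norm h"
    using Cauchy_Schwarz_sq_norm[OF g h] by (simp add: norm_mult)
  finally show ?thesis .
qed




lemma sq_norm_eq_0_iff:
  assumes g: "g \<in> sq_integrable"
  shows "sq_norm g = 0 \<longleftrightarrow> (AE t in circ_measure. g t = 0)"
  using integral_nonneg_eq_0_iff_AE[OF sq_integrable_integrable_sq[OF g]]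
  by (simp add: sq_norm_def)

lemma circ_inner_self:
  "circ_inner g g = (sq_norm g)\<^sup>2"
proof -
  have "circ_inner g g = (LINT t|circ_measure. complex_of_real ((cmod (g t))\<^sup>2))"
    unfolding circ_inner_def complex_norm_square by simp
  then show ?thesis
    by (simp add: sq_norm_power2 flip: of_real_power)
qed

lemma cnj_circ_inner: "cnj (circ_inner g h) = circ_inner h g"
  using Bochner_Integration.integral_cnj[of circ_measure "\<lambda>t. g t * cnj (h t)"]
  by (simp add: circ_inner_def mult.commute)

lemma circ_inner_diff_left:
  assumes "g \<in> sq_integrable" "h \<in> sq_integrable" "k \<in> sq_integrable"
  shows "circ_inner (\<lambda>t. g t - h t) k = circ_inner g k - circ_inner h k"
  using assms unfolding circ_inner_def
  by (simp add: left_diff_distrib integrable_mult_sq_integrable sq_integrable_cnj)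

lemma sq_norm_diff_power2:
  assumes g: "g \<in> sq_integrable" and h: "h \<in> sq_integrable"
  shows "(sq_norm (\<lambda>t. g t - h t))\<^sup>2 = (sq_norm g)\<^sup>2 - 2 * Re (circ_inner g h) + (sq_norm h)\<^sup>2"
proof -
  let ?d = "\<lambda>t. g t - h t"
  note d = sq_integrable_diff[OF g h]
  have "circ_inner ?d ?d = cnj (circ_inner ?d g) - cnj (circ_inner ?d h)"
    using circ_inner_diff_left[OF g h d] by (simp add: cnj_circ_inner)
  also have "\<dots> = cnj (circ_inner g g) - circ_inner g h - cnj (circ_inner g h) + cnj (circ_inner h h)"
    using circ_inner_diff_left[OF g h g] circ_inner_diff_left[OF g h h] by (simp add: cnj_circ_inner)
  finally have "Re (circ_inner ?d ?d) = Re (\<dots>)"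
    by (rule arg_cong)
  then show ?thesis
    by (simp add: circ_inner_self flip: of_real_power)
qed

subsection \<open>Fourier coefficients and the Bessel identity\<close>

lemma integral_lebesgue_on_cis:
  "(LINT t|circ_measure. cis (of_int k * t)) = (if k = 0 then 2 * pi else 0)"
proof (cases "k = 0")
  case True
  then show ?thesis by (simp add: measure_restrict_space scaleR_conv_of_real)
next
  case False
  have "((\<lambda>t. cis (of_int k * t)) has_integral
      (cis (of_int k * pi) / (\<i> * of_int k) - cis (of_int k * (- pi)) / (\<i> * of_int k))) {-pi..pi}"
  proof (rule fundamental_theorem_of_calculus)
    fix t assume "t \<in> {-pi..pi}"
    have "((\<lambda>x. exp (\<i> * of_int k * x) / (\<i> * of_int k)) has_field_derivative
        exp (\<i> * of_int k * of_real t)) (at (of_real t))"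
      using False by (auto intro!: derivative_eq_intros)
    from has_vector_derivative_real_field[OF this, of "{-pi..pi}"]
    show "((\<lambda>t. cis (of_int k * t) / (\<i> * of_int k)) has_vector_derivative
        cis (of_int k * t)) (at t within {-pi..pi})"
      by (simp add: cis_conv_exp mult_ac)
  qed simp
  moreover have "cis (of_int k * pi) = cis (of_int k * (- pi))"
    by (simp add: complex_eq_iff sin_times_pi_eq_0)
  ultimately have "integral {-pi..pi} (\<lambda>t. cis (of_int k * t)) = 0"
    by (simp add: integral_unique)
  moreover have "integrable circ_measure (\<lambda>t. cis (of_int k * t))"
    by (intro integrable_sq_integrable sq_integrable_cis)
  ultimately show ?thesis
    using False by (simp add: lebesgue_integral_eq_integral)
qed

lemma sq_integrable_fourier_sum: "fourier_sum f A \<in> sq_integrable"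
proof -
  have "(\<lambda>t. f m * cis (- (of_int m * t))) \<in> sq_integrable" for m
    using sq_integrable_cmult[OF sq_integrable_cis[of "- of_int m"]] by simp
  then show ?thesis
    unfolding fourier_sum_def[abs_def]
    by (rule sq_integrable_cmult[OF sq_integrable_sum])
qed

lemma integrable_mult_cis:
  "g \<in> sq_integrable \<Longrightarrow> integrable circ_measure (\<lambda>t. g t * cis (a * t))"
  by (intro integrable_mult_sq_integrable sq_integrable_cis)

lemma fcoeff_add:
  assumes "g \<in> sq_integrable" "h \<in> sq_integrable"
  shows "fcoeff (\<lambda>t. g t + h t) m = fcoeff g m + fcoeff h m"
  using assms by (simp add: fcoeff_def distrib_right integrable_mult_cis distrib_left add_divide_distrib)

lemma fcoeff_diff:
  assumes "g \<in> sq_integrable" "h \<in> sq_integrable"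
  shows "fcoeff (\<lambda>t. g t - h t) m = fcoeff g m - fcoeff h m"
  using assms by (simp add: fcoeff_def left_diff_distrib integrable_mult_cis diff_divide_distrib)

lemma fcoeff_cmult: "fcoeff (\<lambda>t. c * g t) m = c * fcoeff g m"
  by (simp add: fcoeff_def mult.assoc)

lemma fcoeff_mult_cis: "fcoeff (\<lambda>t. cis t * g t) m = fcoeff g (m + 1)"
proof -
  have "cis t * g t * cis (of_int m * t) = g t * cis (of_int (m + 1) * t)" for t
    using cis_mult[of t "of_int m * t"] by (simp add: distrib_right add.commute mult.assoc mult.left_commute)
  then show ?thesis unfolding fcoeff_def by (simp only:)
qed

lemma fcoeff_cong_AE:
  assumes "g \<in> sq_integrable" "h \<in> sq_integrable" "AE t in circ_measure. g t = h t"
  shows "fcoeff g = fcoeff h"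
proof
  fix m
  note [measurable] = assms(1,2)[THEN sq_integrable_measurable]
  have "(LINT t|circ_measure. g t * cis (of_int m * t)) = (LINT t|circ_measure. h t * cis (of_int m * t))"
    using assms(3) by (intro integral_cong_AE) auto
  then show "fcoeff g m = fcoeff h m" by (simp add: fcoeff_def)
qed

lemma fcoeff_fourier_sum:
  assumes "finite A"
  shows "fcoeff (fourier_sum f A) m = (if m \<in> A then f m else 0)"
proof -
  have "fcoeff (fourier_sum f A) m =
      1 / sqrt (2 * pi) * (LINT t|circ_measure. (\<Sum>j\<in>A. 1 / sqrt (2 * pi) * f j * cis (of_int (m - j) * t)))"
  proof -
    have "fourier_sum f A t * cis (of_int m * t) =
        (\<Sum>j\<in>A. 1 / sqrt (2 * pi) * f j * cis (of_int (m - j) * t))" for t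
      unfolding fourier_sum_def sum_distrib_left sum_distrib_right
      by (intro sum.cong refl) (simp add: mult.assoc cis_mult algebra_simps)
    then show ?thesis by (simp add: fcoeff_def)
  qed
  also have "\<dots> = 1 / sqrt (2 * pi) *
      (\<Sum>j\<in>A. 1 / sqrt (2 * pi) * f j * (LINT t|circ_measure. cis (of_int (m - j) * t)))"
    using sq_integrable_cis by (subst Bochner_Integration.integral_sum)
      (simp_all only: integral_mult_right_zero integrable_sq_integrable sq_integrable_cmult)
  also have "\<dots> = (\<Sum>j\<in>A. if j = m then f j else 0)"
    unfolding integral_lebesgue_on_cis sum_distrib_left
    by (intro sum.cong refl) (auto simp flip: of_real_mult)
  also have "\<dots> = (if m \<in> A then f m else 0)"
    using assms by simp
  finally show ?thesis .
qed

lemma circ_inner_fourier_sum: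
  assumes g: "g \<in> sq_integrable"
  shows "circ_inner (fourier_sum f A) g = (\<Sum>m\<in>A. f m * cnj (fcoeff g m))"
proof -
  have int: "integrable circ_measure (\<lambda>t. g t * cis (of_int m * t))" for m :: int
    by (intro integrable_mult_cis g)
  have "circ_inner (fourier_sum f A) g =
      (LINT t|circ_measure. (\<Sum>m\<in>A. f m / sqrt (2 * pi) * cnj (g t * cis (of_int m * t))))"
    unfolding circ_inner_def fourier_sum_def sum_distrib_left sum_distrib_right
    by (intro Bochner_Integration.integral_cong refl sum.cong) (simp add: cis_cnj mult_ac)
  also have "\<dots> = (\<Sum>m\<in>A. f m / sqrt (2 * pi) * cnj (LINT t|circ_measure. g t * cis (of_int m * t)))"
    unfolding Bochner_Integration.integral_cnj[symmetric]
    using int by (subst Bochner_Integration.integral_sum)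
      (auto simp del: complex_cnj_mult Bochner_Integration.integral_cnj simp: integrable_cnj)
  also have "\<dots> = (\<Sum>m\<in>A. f m * cnj (fcoeff g m))"
    by (simp add: fcoeff_def)
  finally show ?thesis .
qed

lemma sq_norm_fourier_sum:
  assumes "finite A"
  shows "(sq_norm (fourier_sum f A))\<^sup>2 = (\<Sum>m\<in>A. (cmod (f m))\<^sup>2)"
proof -
  have "complex_of_real ((sq_norm (fourier_sum f A))\<^sup>2) = (\<Sum>m\<in>A. f m * cnj (f m))"
    unfolding circ_inner_self[symmetric] circ_inner_fourier_sum[OF sq_integrable_fourier_sum]
    using assms by (intro sum.cong refl) (simp add: fcoeff_fourier_sum)
  also have "\<dots> = complex_of_real (\<Sum>m\<in>A. (cmod (f m))\<^sup>2)"
    unfolding of_real_sum complex_norm_square ..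
  finally show ?thesis
    by (simp only: of_real_eq_iff)
qed

text \<open>When the square is expanded, the cross term contributes -2 and the norm of the partial
  sum +1 times the same sum of squared coefficients. The error of a partial sum thus measures
  exactly what is missing from Parseval's identity.\<close>

lemma Bessel_identity:
  assumes g: "g \<in> sq_integrable" and A: "finite A"
  shows "(sq_norm (\<lambda>t. fourier_sum (fcoeff g) A t - g t))\<^sup>2 =
    (sq_norm g)\<^sup>2 - (\<Sum>m\<in>A. (cmod (fcoeff g m))\<^sup>2)"
proof -
  have "Re (circ_inner (fourier_sum (fcoeff g) A) g) = (\<Sum>m\<in>A. (cmod (fcoeff g m))\<^sup>2)"
    unfolding circ_inner_fourier_sum[OF g] complex_norm_square[symmetric]
    by (simp flip: of_real_power of_real_sum)
  then show ?thesis
    by (simp add: sq_norm_diff_power2 sq_integrable_fourier_sum g sq_norm_fourier_sum A)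
qed

lemma sum_fcoeff_le:
  assumes g: "g \<in> sq_integrable" and A: "finite A"
  shows "(\<Sum>m\<in>A. (cmod (fcoeff g m))\<^sup>2) \<le> (sq_norm g)\<^sup>2"
  using Bessel_identity[OF assms] zero_le_power2[of "sq_norm (\<lambda>t. fourier_sum (fcoeff g) A t - g t)"]
  by linarith

lemma cmod_fcoeff_le:
  assumes g: "g \<in> sq_integrable"
  shows "cmod (fcoeff g m) \<le> sq_norm g"
  using sum_fcoeff_le[OF g, of "{m}"] by (auto intro: power2_le_imp_le)

lemma fcoeff_in_l2:
  assumes g: "g \<in> sq_integrable"
  shows "fcoeff g \<in> l2"
  unfolding l2_def mem_Collect_eq
  by (rule nonneg_bdd_above_summable_on) (auto intro!: bdd_aboveI2 sum_fcoeff_le[OF g])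

subsection \<open>The Riesz--Fischer theorem\<close>

text \<open>Two partial sums whose index sets contain A share the terms in A, so by orthogonality
  their distance is governed by the coefficients outside A; A is chosen to leave at most e^2 of the
  total.\<close>

lemma fourier_sum_tails:
  assumes f: "f \<in> l2" and e: "e > 0"
  obtains A where "finite A" "\<And>B C. finite B \<Longrightarrow> finite C \<Longrightarrow> A \<subseteq> B \<Longrightarrow> A \<subseteq> C \<Longrightarrow>
    sq_norm (\<lambda>t. fourier_sum f B t - fourier_sum f C t) \<le> e"
proof -
  let ?q = "\<lambda>m. (cmod (f m))\<^sup>2"
  have summ: "?q summable_on UNIV"
    using f by (simp add: l2_def)
  then have "(?q has_sum infsum ?q UNIV) UNIV"
    by simp
  then have "\<forall>\<^sub>F A in finite_subsets_at_top UNIV. sum ?q A > infsum ?q UNIV - e\<^sup>2"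
    unfolding has_sum_def using e by (intro order_tendstoD(1)) auto
  then obtain A where A: "finite A" "sum ?q A > infsum ?q UNIV - e\<^sup>2"
    by (auto simp: eventually_finite_subsets_at_top)
  have "sq_norm (\<lambda>t. fourier_sum f B t - fourier_sum f C t) \<le> e"
    if BC: "finite B" "finite C" "A \<subseteq> B" "A \<subseteq> C" for B C
  proof -
    \<comment> \<open>Coefficients extended by 0 make the difference a single partial sum over the
      union of B and C; on A they cancel.\<close>
    let ?d = "\<lambda>m. (if m \<in> B then f m else 0) - (if m \<in> C then f m else 0)"
    have fin: "finite (B \<union> C)" using BC by simp
    have "fourier_sum f B t - fourier_sum f C t = fourier_sum ?d (B \<union> C) t" for t
    proof -
      have "(\<Sum>m\<in>B. f m * cis (- (of_int m * t))) =
          (\<Sum>m\<in>B \<union> C. (if m \<in> B then f m else 0) * cis (- (of_int m * t)))"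
        "(\<Sum>m\<in>C. f m * cis (- (of_int m * t))) =
          (\<Sum>m\<in>B \<union> C. (if m \<in> C then f m else 0) * cis (- (of_int m * t)))"
        using fin by (auto intro!: sum.mono_neutral_cong_left)
      then show ?thesis
        by (simp add: fourier_sum_def left_diff_distrib sum_subtractf right_diff_distrib
          flip: diff_divide_distrib)
    qed
    then have "(sq_norm (\<lambda>t. fourier_sum f B t - fourier_sum f C t))\<^sup>2 = (\<Sum>m\<in>B \<union> C. (cmod (?d m))\<^sup>2)"
      using sq_norm_fourier_sum[OF fin, of ?d] by presburger
    also have "\<dots> \<le> (\<Sum>m\<in>B \<union> C. if m \<in> A then 0 else ?q m)"
      using BC by (intro sum_mono) auto
    also have "\<dots> = sum ?q (B \<union> C) - sum ?q A"
    proof -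
      have "(\<Sum>m\<in>B \<union> C. if m \<in> A then 0 else ?q m) = (\<Sum>m\<in>B \<union> C - A. ?q m)"
        using fin by (intro sum.mono_neutral_cong_right) auto
      then show ?thesis
        using sum_diff[OF fin, of A ?q] BC by auto
    qed
    also have "\<dots> \<le> infsum ?q UNIV - sum ?q A"
      using finite_sum_le_infsum[OF summ fin] by simp
    also have "\<dots> \<le> e\<^sup>2"
      using A by simp
    finally show ?thesis
      using e by (auto intro: power2_le_imp_le)
  qed
  with A show thesis by (intro that) auto
qed

text \<open>
  A subsequence of partial sums with summable increments in \<open>L1\<close> converges almost
  everywhere; Fatou's lemma then controls the mean-square distance to its limit.
\<close>

lemma Riesz_Fischer:
  assumes f: "f \<in> l2"
  obtains g where "g \<in> sq_integrable"
    "((\<lambda>A. sq_norm (\<lambda>t. fourier_sum f A t - g t)) \<longlongrightarrow> 0) (finite_subsets_at_top UNIV)"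
proof -
  have "\<exists>A. finite A \<and> (\<forall>B C. finite B \<longrightarrow> finite C \<longrightarrow> A \<subseteq> B \<longrightarrow> A \<subseteq> C \<longrightarrow>
      sq_norm (\<lambda>t. fourier_sum f B t - fourier_sum f C t) \<le> (1/2)^k)" for k
    using fourier_sum_tails[OF f, of "(1/2)^k"] by (metis zero_less_divide_1_iff zero_less_numeral zero_less_power)
  then obtain A where A: "\<And>k. finite (A k)" "\<And>k B C. finite B \<Longrightarrow> finite C \<Longrightarrow> A k \<subseteq> B \<Longrightarrow> A k \<subseteq> C \<Longrightarrow>
      sq_norm (\<lambda>t. fourier_sum f B t - fourier_sum f C t) \<le> (1/2)^k"
    by metis
  \<comment> \<open>With unions, the index set of \<open>S k\<close> contains every
    \<open>A j\<close> with j at most k, so \<open>S k\<close> obeys the estimates at all scales up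
    to k.\<close>
  define S where "S k = fourier_sum f (\<Union>j\<le>k. A j)" for k
  have S_sq: "S k \<in> sq_integrable" for k
    by (simp add: S_def sq_integrable_fourier_sum)
  note [measurable] = S_sq[THEN sq_integrable_measurable]
  have S_close: "sq_norm (\<lambda>t. fourier_sum f C t - S k t) \<le> (1/2)^j"
    if "finite C" "A j \<subseteq> C" "j \<le> k" for C j k
    unfolding S_def using A(1) that by (intro A(2)) auto
  define D where "D k t = cmod (S (Suc k) t - S k t)" for k t
  have D_meas [measurable]: "D k \<in> borel_measurable circ_measure" for k
    unfolding D_def[abs_def] by measurable
  have one: "(\<lambda>t. 1) \<in> sq_integrable"
    by (rule sq_integrable_bounded[where B=1]) auto
  \<comment> \<open>The norm of the constant 1 is the price of passing from mean-square to L1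
    increments; the bounds (1/2)^k c remain summable.\<close>
  define c where "c = sq_norm (\<lambda>t. 1)"
  have D_le: "(\<integral>\<^sup>+t. ennreal (D k t) \<partial>circ_measure) \<le> ennreal ((1/2)^k * c)" for k
  proof -
    have d: "(\<lambda>t. S (Suc k) t - S k t) \<in> sq_integrable"
      by (intro sq_integrable_diff S_sq)
    then have int: "integrable circ_measure (D k)"
      unfolding D_def[abs_def] by (rule integrable_norm[OF integrable_sq_integrable])
    then have "(\<integral>\<^sup>+t. ennreal (D k t) \<partial>circ_measure) = ennreal (LINT t|circ_measure. D k t)"
      by (rule nn_integral_eq_integral) (simp add: D_def)
    also have "(LINT t|circ_measure. D k t) \<le> sq_norm (\<lambda>t. S (Suc k) t - S k t) * c"
      using Cauchy_Schwarz_sq_norm[OF d one] by (simp add: D_def c_def)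
    also have "\<dots> \<le> (1/2)^k * c"
    proof (intro mult_right_mono)
      show "sq_norm (\<lambda>t. S (Suc k) t - S k t) \<le> (1/2)^k"
        unfolding S_def[of "Suc k"] using A(1) by (intro S_close UN_upper) auto
    qed (simp add: c_def)
    finally show ?thesis by (simp add: ennreal_leI)
  qed
  have "(\<integral>\<^sup>+t. (\<Sum>k. ennreal (D k t)) \<partial>circ_measure) = (\<Sum>k. \<integral>\<^sup>+t. ennreal (D k t) \<partial>circ_measure)"
    by (rule nn_integral_suminf) measurable
  also have "\<dots> \<le> (\<Sum>k. ennreal ((1/2)^k * c))"
    by (intro suminf_le D_le) auto
  also have "\<dots> < \<infinity>"
  proof -
    have "summable (\<lambda>k. (1/2)^k * c)"
      by (intro summable_mult2 summable_geometric) auto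
    then have "(\<Sum>k. ennreal ((1/2)^k * c)) \<noteq> top"
      by (intro ennreal_suminf_neq_top) (auto simp: c_def)
    then show ?thesis by (simp add: top.not_eq_extremum)
  qed
  finally have "AE t in circ_measure. (\<Sum>k. ennreal (D k t)) \<noteq> \<infinity>"
    by (intro nn_integral_PInf_AE) auto
  then have conv: "AE t in circ_measure. (\<lambda>k. S k t) \<longlonglongrightarrow> lim (\<lambda>k. S k t)"
  proof eventually_elim
    case (elim t)
    then have "summable (\<lambda>k. D k t)"
      by (intro summable_suminf_not_top) (auto simp: D_def)
    then have "summable (\<lambda>k. S (Suc k) t - S k t)"
      unfolding D_def by (rule summable_norm_cancel)
    then have "convergent (\<lambda>n. S n t - S 0 t)"
      unfolding summable_iff_convergent by (simp add: sum_lessThan_telescope[of "\<lambda>k. S k t"])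
    then show ?case
      by (metis convergent_diff_const_right_iff convergent_LIMSEQ_iff)
  qed
  \<comment> \<open>Where the sequence diverges the value of \<open>lim\<close> is arbitrary, but
    that happens only on a null set.\<close>
  define g where "g t = lim (\<lambda>k. S k t)" for t
  have [measurable]: "g \<in> borel_measurable circ_measure"
    unfolding g_def[abs_def] by (rule borel_measurable_lim_metric) measurable
  \<comment> \<open>\<open>sq_norm\<close> is 0 when the squared modulus is not integrable, so the
    bound is informative only together with membership. A finite bound on the nonnegative integral
    yields both.\<close>
  have close: "(\<lambda>t. fourier_sum f C t - g t) \<in> sq_integrable \<and>
      sq_norm (\<lambda>t. fourier_sum f C t - g t) \<le> (1/2)^j" if C: "finite C" "A j \<subseteq> C" for C j
  proof -
    note [measurable] = sq_integrable_measurable[OF sq_integrable_fourier_sum[of f C]]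
    let ?h = "\<lambda>t. fourier_sum f C t - g t"
    have "(\<integral>\<^sup>+t. ennreal ((cmod (?h t))\<^sup>2) \<partial>circ_measure) =
        (\<integral>\<^sup>+t. liminf (\<lambda>k. ennreal ((cmod (fourier_sum f C t - S k t))\<^sup>2)) \<partial>circ_measure)"
    proof (rule nn_integral_cong_AE)
      show "AE t in circ_measure. ennreal ((cmod (?h t))\<^sup>2) =
          liminf (\<lambda>k. ennreal ((cmod (fourier_sum f C t - S k t))\<^sup>2))"
        using conv
      proof eventually_elim
        case (elim t)
        then have "(\<lambda>k. ennreal ((cmod (fourier_sum f C t - S k t))\<^sup>2)) \<longlonglongrightarrow> ennreal ((cmod (?h t))\<^sup>2)"
          unfolding g_def by (intro tendsto_intros)
        then show ?case
          by (metis lim_imp_Liminf sequentially_bot)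
      qed
    qed
    also have "\<dots> \<le> liminf (\<lambda>k. \<integral>\<^sup>+t. ennreal ((cmod (fourier_sum f C t - S k t))\<^sup>2) \<partial>circ_measure)"
      by (rule nn_integral_liminf) measurable
    also have "\<dots> = liminf (\<lambda>k. ennreal ((sq_norm (\<lambda>t. fourier_sum f C t - S k t))\<^sup>2))"
      by (intro arg_cong[where f=liminf] ext nn_integral_sq_norm sq_integrable_diff
          sq_integrable_fourier_sum S_sq)
    also have "\<dots> \<le> ennreal (((1/2)^j)\<^sup>2)"
    proof (rule Liminf_le)
      show "\<forall>\<^sub>F k in sequentially.
          ennreal ((sq_norm (\<lambda>t. fourier_sum f C t - S k t))\<^sup>2) \<le> ennreal (((1/2)^j)\<^sup>2)"
        using eventually_ge_at_top[of j]
        by eventually_elim (intro ennreal_leI power_mono S_close C, auto)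
    qed auto
    finally have le: "(\<integral>\<^sup>+t. ennreal ((cmod (?h t))\<^sup>2) \<partial>circ_measure) \<le> ennreal (((1/2)^j)\<^sup>2)" .
    then have "(\<integral>\<^sup>+t. ennreal ((cmod (?h t))\<^sup>2) \<partial>circ_measure) < \<infinity>"
      by (rule le_less_trans) auto
    then have sq: "?h \<in> sq_integrable"
      by (auto simp: sq_integrable_def integrable_iff_bounded)
    have "sq_norm ?h \<le> (1/2)^j"
      using le unfolding nn_integral_sq_norm[OF sq] by (auto intro: power2_le_imp_le)
    with sq show ?thesis by simp
  qed
  show thesis
  proof
    show "g \<in> sq_integrable"
      using sq_integrable_diff[OF sq_integrable_fourier_sum[of f "A 0"] conjunct1[OF close[of "A 0" 0]]] A(1)
      by simp
    show "((\<lambda>A. sq_norm (\<lambda>t. fourier_sum f A t - g t)) \<longlongrightarrow> 0) (finite_subsets_at_top UNIV)"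
    proof (rule tendstoI)
      fix e :: real assume "e > 0"
      then obtain j where j: "(1/2)^j < e"
        using real_arch_pow_inv[of e "1/2"] by auto
      show "\<forall>\<^sub>F C in finite_subsets_at_top UNIV. dist (sq_norm (\<lambda>t. fourier_sum f C t - g t)) 0 < e"
        unfolding eventually_finite_subsets_at_top
        using A(1)[of j] close[of _ j] j by (intro exI[of _ "A j"]) (auto intro: le_less_trans)
    qed
  qed
qed

subsection \<open>Uniqueness of Fourier coefficients\<close>

text \<open>Asking for all frequencies makes the set closed under multiplication by exponentials,
  hence by polynomials restricted to the unit circle; the density argument then looks only at the
  coefficient at 0.\<close>

definition trig_annihilator :: "(real \<Rightarrow> complex) set" where
  "trig_annihilator = {h. integrable circ_measure h \<and>
     (\<forall>m. (LINT t|circ_measure. h t * cis (of_int m * t)) = 0)}"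

lemma integrable_mult_bounded_right:
  fixes h k :: "real \<Rightarrow> complex"
  assumes h: "integrable circ_measure h" and [measurable]: "k \<in> borel_measurable circ_measure"
    and B: "\<And>t. cmod (k t) \<le> B"
  shows "integrable circ_measure (\<lambda>t. h t * k t)"
proof (rule Bochner_Integration.integrable_bound)
  show "integrable circ_measure (\<lambda>t. of_real B * h t)"
    using h by simp
  have "cmod (h t) * cmod (k t) \<le> cmod (h t) * \<bar>B\<bar>" for t
    using B[of t] by (intro mult_left_mono) auto
  then show "AE t in circ_measure. norm (h t * k t) \<le> norm (of_real B * h t)"
    by (simp add: norm_mult mult.commute)
  show "(\<lambda>t. h t * k t) \<in> borel_measurable circ_measure"
    using borel_measurable_integrable[OF h] by measurable
qed

lemma trig_annihilator_mult_cis: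
  assumes h: "h \<in> trig_annihilator"
  shows "(\<lambda>t. h t * cis (of_int j * t)) \<in> trig_annihilator"
proof -
  have "h t * cis (of_int j * t) * cis (of_int m * t) = h t * cis (of_int (j + m) * t)" for t m
    by (simp add: mult.assoc cis_mult distrib_right)
  moreover have "integrable circ_measure (\<lambda>t. h t * cis (of_int j * t))"
    using h by (intro integrable_mult_bounded_right[where B=1]) (auto simp: trig_annihilator_def)
  ultimately show ?thesis
    using h by (simp only: trig_annihilator_def mem_Collect_eq) blast
qed

lemma trig_annihilator_add:
  assumes "h \<in> trig_annihilator" "k \<in> trig_annihilator"
  shows "(\<lambda>t. h t + k t) \<in> trig_annihilator"
proof -
  have "integrable circ_measure (\<lambda>t. h t * cis (of_int m * t))"
    "integrable circ_measure (\<lambda>t. k t * cis (of_int m * t))" for m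
    using assms by (auto intro!: integrable_mult_bounded_right[where B=1] simp: trig_annihilator_def)
  with assms show ?thesis
    by (auto simp: trig_annihilator_def distrib_right)
qed

lemma trig_annihilator_cmult:
  "h \<in> trig_annihilator \<Longrightarrow> (\<lambda>t. c * h t) \<in> trig_annihilator"
  by (auto simp: trig_annihilator_def mult.assoc)

text \<open>Real polynomial functions on the plane are generated by real-linear functionals and
  constants, and on the circle each functional is a combination of \<open>cis t\<close> and
  \<open>cis (- t)\<close>, which only shift frequencies. \<open>h\<close> stays arbitrary in the
  induction because a product applies the two hypotheses in succession.\<close>

lemma trig_annihilator_mult_polynomial:
  fixes p :: "complex \<Rightarrow> real"
  assumes "real_polynomial_function p" and "h \<in> trig_annihilator"
  shows "(\<lambda>t. h t * of_real (p (cis t))) \<in> trig_annihilator"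
  using assms
proof (induction p arbitrary: h rule: real_polynomial_function.induct)
  case (linear f)
  interpret f: bounded_linear f by fact
  \<comment> \<open>Euler's formulas: f (cis t) = f(1) cos t + f(\<i>) sin t, rewritten in the two
    exponentials.\<close>
  define c where "c = (f 1 - \<i> * f \<i>) / 2"
  define d where "d = (f 1 + \<i> * f \<i>) / 2"
  have "(\<lambda>t. c * (h t * cis (of_int 1 * t)) + d * (h t * cis (of_int (-1) * t))) \<in> trig_annihilator"
    by (intro trig_annihilator_add trig_annihilator_cmult trig_annihilator_mult_cis linear)
  moreover have "c * (h t * cis (of_int 1 * t)) + d * (h t * cis (of_int (-1) * t))
      = h t * of_real (f (cis t))" for t
  proof -
    have "cis t = cos t *\<^sub>R 1 + sin t *\<^sub>R \<i>"
      by (simp add: complex_eq_iff)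
    then have "f (cis t) = cos t * f 1 + sin t * f \<i>"
      by (metis f.add f.scaleR real_scaleR_def)
    moreover have "c * cis t + d * cis (- t) = of_real (cos t * f 1 + sin t * f \<i>)"
      by (rule complex_eqI) (simp_all add: c_def d_def flip: add_divide_distrib)
    ultimately have "of_real (f (cis t)) = c * cis t + d * cis (- t)"
      by simp
    then show ?thesis
      by (simp add: algebra_simps)
  qed
  ultimately show ?case by simp
next
  case (const c)
  then show ?case
    using trig_annihilator_cmult[of h "of_real c"] by (simp add: mult.commute)
next
  case (add f g)
  then show ?case
    using trig_annihilator_add[OF add.IH(1)[of h] add.IH(2)[of h]] by (simp add: distrib_left)
next
  case (mult f g)
  then show ?case
    using mult.IH(2)[OF mult.IH(1)[of h]] by (simp add: mult.assoc)
qed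

text \<open>The coefficient at 0 of h times a polynomial p vanishes, so \<phi> may be replaced by
  \<phi> - p, which Stone--Weierstrass makes uniformly small on the circle; the integral is then at
  most e times the L1 norm of h.\<close>

lemma trig_annihilator_continuous:
  fixes \<phi> :: "complex \<Rightarrow> real"
  assumes h: "h \<in> trig_annihilator" and \<phi>: "continuous_on (sphere 0 1) \<phi>"
  shows "integrable circ_measure (\<lambda>t. h t * of_real (\<phi> (cis t)))"
    and "(LINT t|circ_measure. h t * of_real (\<phi> (cis t))) = 0"
proof -
  have int: "integrable circ_measure h"
    using h by (simp add: trig_annihilator_def)
  have intc: "integrable circ_measure (\<lambda>t. h t * of_real (\<psi> (cis t)))"
    if \<psi>: "continuous_on (sphere 0 1) \<psi>" for \<psi> :: "complex \<Rightarrow> real"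
  proof -
    have "bounded (\<psi> ` sphere 0 1)"
      by (intro compact_imp_bounded compact_continuous_image \<psi>) auto
    then obtain B where "\<forall>z\<in>sphere 0 1. \<bar>\<psi> z\<bar> \<le> B"
      unfolding bounded_iff by auto
    moreover have "continuous_on {-pi..pi} (\<lambda>t. complex_of_real (\<psi> (cis t)))"
      by (intro continuous_on_of_real continuous_on_compose2[OF \<psi>] continuous_intros) auto
    ultimately show ?thesis
      using int by (intro integrable_mult_bounded_right[where B=B] continuous_imp_measurable_on_sets_lebesgue) auto
  qed
  show "integrable circ_measure (\<lambda>t. h t * of_real (\<phi> (cis t)))"
    using \<phi> by (rule intc)
  let ?I = "LINT t|circ_measure. h t * of_real (\<phi> (cis t))"
  let ?N = "LINT t|circ_measure. cmod (h t)"
  have bound: "cmod ?I \<le> e * ?N" if "e > 0" for e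
  proof -
    obtain p where p: "real_polynomial_function p" "\<And>z. z \<in> sphere 0 1 \<Longrightarrow> \<bar>\<phi> z - p z\<bar> < e"
      using Stone_Weierstrass_real_polynomial_function[OF compact_sphere \<phi> \<open>e > 0\<close>]
      by blast
    have contp: "continuous_on (sphere 0 1) p"
      using p(1) by (simp add: continuous_on_polymonial_function real_polynomial_function_eq)
    have "(\<lambda>t. h t * of_real (p (cis t))) \<in> trig_annihilator"
      using p(1) h by (rule trig_annihilator_mult_polynomial)
    then have "\<forall>m. (LINT t|circ_measure. h t * of_real (p (cis t)) * cis (of_int m * t)) = 0"
      by (simp add: trig_annihilator_def)
    from this[rule_format, of 0] have "(LINT t|circ_measure. h t * of_real (p (cis t))) = 0"
      by simp
    then have "?I = (LINT t|circ_measure. h t * of_real (\<phi> (cis t) - p (cis t)))"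
      using intc[OF \<phi>] intc[OF contp] by (simp add: right_diff_distrib)
    then have "cmod ?I \<le> (LINT t|circ_measure. cmod (h t * of_real (\<phi> (cis t) - p (cis t))))"
      by (simp only: integral_norm_bound)
    also have "\<dots> \<le> (LINT t|circ_measure. e * cmod (h t))"
    proof (rule integral_mono)
      show "integrable circ_measure (\<lambda>t. cmod (h t * of_real (\<phi> (cis t) - p (cis t))))"
        by (intro integrable_norm intc continuous_on_diff \<phi> contp)
      show "integrable circ_measure (\<lambda>t. e * cmod (h t))"
        using int by simp
      show "cmod (h t * of_real (\<phi> (cis t) - p (cis t))) \<le> e * cmod (h t)" for t
        using p(2)[of "cis t"] unfolding norm_mult norm_of_real
        by (subst mult.commute) (intro mult_right_mono, auto)
    qed
    finally show ?thesis by simp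
  qed
  have N: "?N \<ge> 0"
    by (rule Bochner_Integration.integral_nonneg) simp
  have "cmod ?I \<le> 0"
  proof (rule field_le_epsilon)
    fix e :: real assume e: "0 < e"
    \<comment> \<open>The summand 1 keeps the divisor positive when h has L1 norm 0.\<close>
    have "cmod ?I \<le> e / (?N + 1) * ?N"
      using e N by (intro bound divide_pos_pos) linarith+
    also have "\<dots> = e * (?N / (?N + 1))"
      by (rule times_divide_eq_left[THEN trans], rule times_divide_eq_right[symmetric])
    also have "\<dots> \<le> e * 1"
      using e N by (intro mult_left_mono) (auto simp only: divide_le_eq_1)
    finally show "cmod ?I \<le> 0 + e"
      by (simp only: mult_1_right add_0_left)
  qed
  then show "?I = 0"
    by (simp only: norm_le_zero_iff)
qed

text \<open>The indicator of a closed set is the pointwise limit of continuous functions of the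
  distance, and |h| dominates the integrands. \<open>K \<noteq> {}\<close> is there because
  \<open>infdist\<close> to the empty set is 0, which would make every \<open>\<phi> n\<close> equal
  to 1.\<close>

lemma trig_annihilator_closed:
  assumes h: "h \<in> trig_annihilator" and K: "closed K" "K \<noteq> {}"
  shows "(LINT t|circ_measure. h t * indicator K (cis t)) = 0"
proof -
  define \<phi> where "\<phi> n z = max 0 (1 - of_nat n * infdist z K)" for n :: nat and z
  have int: "integrable circ_measure h"
    using h by (simp add: trig_annihilator_def)
  note [measurable] = borel_measurable_integrable[OF int]
  have cont: "continuous_on S (\<phi> n)" for n S
    unfolding \<phi>_def[abs_def] by (intro continuous_intros)
  have "(\<lambda>n. LINT t|circ_measure. h t * of_real (\<phi> n (cis t)))
      \<longlonglongrightarrow> (LINT t|circ_measure. h t * indicator K (cis t))"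
  proof (rule integral_dominated_convergence[where w="\<lambda>t. cmod (h t)"])
    have "K \<in> sets borel" using K by simp
    moreover have "cis \<in> borel_measurable circ_measure"
      using measurable_cis_lebesgue[of 1] by simp
    ultimately have "(\<lambda>t. indicator K (cis t) :: complex) \<in> borel_measurable circ_measure"
      by (intro measurable_compose[OF _ borel_measurable_indicator])
    then show "(\<lambda>t. h t * indicator K (cis t)) \<in> borel_measurable circ_measure"
      by measurable
    show "(\<lambda>t. h t * of_real (\<phi> n (cis t))) \<in> borel_measurable circ_measure" for n
      by (intro borel_measurable_integrable trig_annihilator_continuous(1) h cont)
    show "integrable circ_measure (\<lambda>t. cmod (h t))"
      using int by simp
    have "\<bar>\<phi> n z\<bar> \<le> 1" for n z
      by (simp add: \<phi>_def infdist_nonneg)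
    then show "AE t in circ_measure. norm (h t * of_real (\<phi> n (cis t))) \<le> cmod (h t)" for n
      by (intro AE_I2) (simp add: norm_mult mult_left_le)
    have "(\<lambda>n. \<phi> n z) \<longlonglongrightarrow> indicator K z" for z
    proof (cases "z \<in> K")
      case True
      then show ?thesis by (simp add: \<phi>_def)
    next
      case False
      then have pos: "infdist z K > 0"
        using K by (simp add: infdist_pos_not_in_closed)
      then obtain N :: nat where N: "1 < of_nat N * infdist z K"
        using reals_Archimedean3 by blast
      have "\<forall>\<^sub>F n in sequentially. \<phi> n z = 0"
        using eventually_ge_at_top[of N]
      proof eventually_elim
        case (elim n)
        then have "of_nat N * infdist z K \<le> of_nat n * infdist z K"
          using pos by (intro mult_right_mono) auto
        with N show ?case by (simp add: \<phi>_def)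
      qed
      then show ?thesis
        using False by (simp add: tendsto_eventually)
    qed
    then have "(\<lambda>n. h t * of_real (\<phi> n (cis t))) \<longlonglongrightarrow> h t * of_real (indicator K (cis t))" for t
      by (intro tendsto_intros)
    then show "AE t in circ_measure. (\<lambda>n. h t * of_real (\<phi> n (cis t))) \<longlonglongrightarrow> h t * indicator K (cis t)"
      by (simp add: of_real_indicator)
  qed
  then show ?thesis
    using trig_annihilator_continuous(2)[OF h cont] by (simp add: LIMSEQ_const_iff)
qed

lemma AE_circ_measure_neq: "AE t in circ_measure. t \<noteq> a"
proof -
  have "AE t in lebesgue. t \<noteq> a"
    by (rule AE_I'[of "{a}"]) (auto simp: negligible_iff_null_sets[symmetric])
  then have "AE t in lebesgue. t \<in> {-pi..pi} \<longrightarrow> t \<noteq> a"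
    by eventually_elim simp
  then show ?thesis
    by (subst AE_restrict_space_iff) auto
qed

text \<open>The image of [a, b] under \<open>cis\<close> is a closed arc. \<open>Arg\<close>
  recovers t from \<open>cis t\<close> on (-pi, pi], so membership in the arc and in the interval
  can differ only at t = -pi, which lands on the arc when b = pi and is a null set.\<close>

lemma trig_annihilator_interval:
  assumes h: "h \<in> trig_annihilator" and ab: "-pi < a" "a \<le> b" "b \<le> pi"
  shows "(LINT t|circ_measure. h t * indicator {a..b} t) = 0"
proof -
  have int: "integrable circ_measure h"
    using h by (simp add: trig_annihilator_def)
  have K: "closed (cis ` {a..b})"
    by (intro compact_imp_closed compact_continuous_image continuous_intros) auto
  have iff: "cis t \<in> cis ` {a..b} \<longleftrightarrow> t \<in> {a..b}" if "t \<in> {-pi..pi}" "t \<noteq> -pi" for t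
  proof
    assume "cis t \<in> cis ` {a..b}"
    then obtain s where s: "s \<in> {a..b}" "cis t = cis s" by auto
    have "Arg (cis s) = t"
      using that unfolding s(2)[symmetric] by (intro Arg_cis) simp
    moreover have "Arg (cis s) = s"
      using s(1) ab by (intro Arg_cis) simp
    ultimately show "t \<in> {a..b}"
      using s(1) by (simp only:)
  qed simp
  have "AE t in circ_measure. h t * indicator (cis ` {a..b}) (cis t) = h t * indicator {a..b} t"
    using AE_circ_measure_neq[of "-pi"] AE_space[of circ_measure]
    by eventually_elim (simp only: indicator_def space_lebesgue_on iff simp_thms)
  moreover have "(\<lambda>t. h t * indicator (cis ` {a..b}) (cis t)) \<in> borel_measurable circ_measure"
  proof -
    have "cis \<in> borel_measurable circ_measure"
      using measurable_cis_lebesgue[of 1] by simp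
    then have "(\<lambda>t. indicator (cis ` {a..b}) (cis t) :: complex) \<in> borel_measurable circ_measure"
      using K by (intro measurable_compose[OF _ borel_measurable_indicator]) auto
    then show ?thesis
      using borel_measurable_integrable[OF int] by measurable
  qed
  moreover have "(\<lambda>t. h t * indicator {a..b} t) \<in> borel_measurable circ_measure"
    by (intro borel_measurable_times[OF borel_measurable_integrable[OF int] measurable_restrict_space1]
        borel_measurable_indicator) auto
  ultimately have "(LINT t|circ_measure. h t * indicator {a..b} t)
      = (LINT t|circ_measure. h t * indicator (cis ` {a..b}) (cis t))"
    by (intro integral_cong_AE) auto
  also have "\<dots> = 0"
    using ab by (intro trig_annihilator_closed h K) auto
  finally show ?thesis .
qed

text \<open>
  By Stone--Weierstrass on the unit circle the integral of \<open>h\<close> over every interval vanishes,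
  so \<open>h\<close> vanishes at all of its Lebesgue points.
\<close>

lemma trig_annihilator_AE_0:
  assumes h: "h \<in> trig_annihilator"
  shows "AE t in circ_measure. h t = 0"
proof -
  \<comment> \<open>Extension by 0 gives a function on the whole line, the setting of the Lebesgue
    differentiation theorem; over intervals inside (-pi, pi] its integrals are those of
    \<open>h\<close>.\<close>
  define f where "f t = (if t \<in> {-pi..pi} then h t else 0)" for t
  have int: "integrable circ_measure h"
    using h by (simp add: trig_annihilator_def)
  have f_int: "integrable lebesgue f"
    unfolding f_def[abs_def] by (rule Lebesgue_Measure.integrable_restrict_UNIV[THEN iffD2]) (use int in auto)
  have f_on: "integrable (lebesgue_on {a..b}) f" for a b
    using integrable_mult_indicator[OF _ f_int, of "{a..b}"] by (simp add: integrable_restrict_space)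
  have f_on': "f integrable_on cbox a b" for a b
    using integrable_on_lebesgue_on[OF f_on] by simp
  have f0: "integral {a..b} f = 0" if ab: "-pi < a" "a \<le> b" "b \<le> pi" for a b
  proof -
    have "integral {a..b} f = (LINT t|lebesgue_on {a..b}. f t)"
      using lebesgue_integral_eq_integral[OF f_on] by simp
    also have "\<dots> = (LINT t|lebesgue_on {a..b}. h t)"
      using ab by (intro Bochner_Integration.integral_cong refl) (auto simp: f_def)
    also have "\<dots> = (LINT t|circ_measure. (if t \<in> {a..b} then h t else 0))"
      using ab by (intro integral_restrict[symmetric]) auto
    also have "\<dots> = (LINT t|circ_measure. h t * indicator {a..b} t)"
      by (intro Bochner_Integration.integral_cong refl) (auto simp: indicator_def)
    finally show ?thesis
      using trig_annihilator_interval[OF h ab] by simp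
  qed
  obtain N where N: "negligible N" "\<And>x e. \<lbrakk>x \<notin> N; 0 < e\<rbrakk> \<Longrightarrow> \<exists>d>0. \<forall>k. 0 < k \<and> k < d \<longrightarrow>
      norm (integral {x..x + k} f /\<^sub>R k - f x) < e"
    using integrable_ccontinuous_explicit[OF f_on'] by (auto simp: cbox_interval)
  have f_0: "f x = 0" if x: "x \<notin> N" "-pi < x" "x < pi" for x
  proof (rule ccontr)
    assume "f x \<noteq> 0"
    then have "cmod (f x) > 0" by simp
    from N(2)[OF x(1) this] obtain d where d: "d > 0"
      "\<And>k. 0 < k \<Longrightarrow> k < d \<Longrightarrow> norm (integral {x..x + k} f /\<^sub>R k - f x) < cmod (f x)"
      by auto
    \<comment> \<open>Short enough for the differentiation estimate and for [x, x + k] to end by pi.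
      There the average is 0, and the estimate reads |f x| < |f x|.\<close>
    define k where "k = min (d/2) (pi - x)"
    have "0 < k" "k < d" "x + k \<le> pi"
      using d x by (auto simp: k_def)
    with d(2)[of k] f0[of x "x + k"] x show False by simp
  qed
  have "AE t in circ_measure. t \<notin> N"
  proof -
    have "AE t in lebesgue. t \<notin> N"
      using N(1) by (intro AE_not_in) (simp add: negligible_iff_null_sets)
    then have "AE t in lebesgue. t \<in> {-pi..pi} \<longrightarrow> t \<notin> N"
      by eventually_elim simp
    then show ?thesis
      by (subst AE_restrict_space_iff) auto
  qed
  then show ?thesis
    using AE_circ_measure_neq[of "-pi"] AE_circ_measure_neq[of pi] AE_space[of circ_measure]
  proof eventually_elim
    case (elim t)
    then show ?case
      using f_0[of t] by (simp add: f_def)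
  qed
qed

lemma fcoeff_eq_iff:
  assumes g: "g \<in> sq_integrable" and h: "h \<in> sq_integrable"
  shows "fcoeff g = fcoeff h \<longleftrightarrow> (AE t in circ_measure. g t = h t)"
proof
  assume eq: "fcoeff g = fcoeff h"
  have "(\<lambda>t. g t - h t) \<in> trig_annihilator"
  proof -
    have "fcoeff (\<lambda>t. g t - h t) m = 0" for m
      using eq by (simp add: fcoeff_diff g h)
    then have "(LINT t|circ_measure. (g t - h t) * cis (of_int m * t)) = 0" for m
      by (simp add: fcoeff_def)
    then show ?thesis
      by (simp add: trig_annihilator_def integrable_sq_integrable g h)
  qed
  from trig_annihilator_AE_0[OF this] show "AE t in circ_measure. g t = h t"
    by simp
qed (rule fcoeff_cong_AE[OF g h])

subsection \<open>Parseval's identity and classes modulo null sets\<close>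

text \<open>A coefficient is bounded by the norm, and once m lies in A the m-th coefficient of the
  partial sum is already f m; the fixed number |f m - fcoeff g m| therefore lies below a quantity
  tending to 0.\<close>

lemma fcoeff_eq_if_fourier_sum_tendsto:
  assumes g: "g \<in> sq_integrable"
    and lim: "((\<lambda>A. sq_norm (\<lambda>t. fourier_sum f A t - g t)) \<longlongrightarrow> 0) (finite_subsets_at_top UNIV)"
  shows "fcoeff g = f"
proof
  fix m
  have "\<forall>\<^sub>F A in finite_subsets_at_top UNIV.
      norm (f m - fcoeff g m) \<le> sq_norm (\<lambda>t. fourier_sum f A t - g t)"
  proof -
    have "norm (f m - fcoeff g m) \<le> sq_norm (\<lambda>t. fourier_sum f A t - g t)"
      if "finite A" "m \<in> A" for A
    proof -
      have "fcoeff (\<lambda>t. fourier_sum f A t - g t) m = f m - fcoeff g m"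
        using that by (simp add: fcoeff_diff sq_integrable_fourier_sum g fcoeff_fourier_sum)
      then show ?thesis
        using cmod_fcoeff_le[OF sq_integrable_diff[OF sq_integrable_fourier_sum[of f A] g], of m] by simp
    qed
    then show ?thesis
      by (auto simp: eventually_finite_subsets_at_top intro!: exI[of _ "{m}"])
  qed
  from tendsto_lowerbound[OF lim this] show "fcoeff g m = f m"
    by simp
qed

lemma fcoeff_surj_l2:
  assumes "f \<in> l2"
  obtains g where "g \<in> sq_integrable" "fcoeff g = f"
  using Riesz_Fischer[OF assms] fcoeff_eq_if_fourier_sum_tendsto by metis

text \<open>Coefficients in \<open>l2\<close> make the series converge to some h; its coefficients
  are those of g, and uniqueness identifies h with g almost everywhere. This is where completeness
  of the exponential system enters.\<close>

lemma fourier_sum_fcoeff_tendsto: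
  assumes g: "g \<in> sq_integrable"
  shows "((\<lambda>A. sq_norm (\<lambda>t. fourier_sum (fcoeff g) A t - g t)) \<longlongrightarrow> 0) (finite_subsets_at_top UNIV)"
proof -
  obtain h where h: "h \<in> sq_integrable"
    "((\<lambda>A. sq_norm (\<lambda>t. fourier_sum (fcoeff g) A t - h t)) \<longlongrightarrow> 0) (finite_subsets_at_top UNIV)"
    using Riesz_Fischer[OF fcoeff_in_l2[OF g]] .
  have "AE t in circ_measure. g t = h t"
    using fcoeff_eq_if_fourier_sum_tendsto[OF h] fcoeff_eq_iff[OF g h(1)] by simp
  then have "sq_norm (\<lambda>t. fourier_sum (fcoeff g) A t - g t) =
      sq_norm (\<lambda>t. fourier_sum (fcoeff g) A t - h t)" for A
    by (intro sq_norm_cong_AE sq_integrable_measurable sq_integrable_diff sq_integrable_fourier_sum g h) auto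
  with h(2) show ?thesis by simp
qed

lemma Parseval_inner:
  assumes g: "g \<in> sq_integrable" and h: "h \<in> sq_integrable"
  shows "l2_inner (fcoeff g) (fcoeff h) = circ_inner g h"
proof -
  let ?S = "fourier_sum (fcoeff g)"
  have "((\<lambda>A. circ_inner (?S A) h - circ_inner g h) \<longlongrightarrow> 0) (finite_subsets_at_top UNIV)"
  proof (rule Lim_null_comparison)
    show "\<forall>\<^sub>F A in finite_subsets_at_top UNIV.
        norm (circ_inner (?S A) h - circ_inner g h) \<le> sq_norm (\<lambda>t. ?S A t - g t) * sq_norm h"
      using cmod_circ_inner_le[OF sq_integrable_diff[OF sq_integrable_fourier_sum g] h]
        circ_inner_diff_left[OF sq_integrable_fourier_sum g h]
      by (intro always_eventually) simp
    show "((\<lambda>A. sq_norm (\<lambda>t. ?S A t - g t) * sq_norm h) \<longlongrightarrow> 0) (finite_subsets_at_top UNIV)"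
      using tendsto_mult_right[OF fourier_sum_fcoeff_tendsto[OF g], of "sq_norm h"] by simp
  qed
  then have "((\<lambda>m. fcoeff g m * cnj (fcoeff h m)) has_sum circ_inner g h) UNIV"
    unfolding has_sum_def circ_inner_fourier_sum[OF h] by (rule LIM_zero_cancel)
  then show ?thesis
    unfolding l2_inner_def by (rule infsumI)
qed

lemma Parseval_norm:
  assumes g: "g \<in> sq_integrable"
  shows "l2_norm (fcoeff g) = sq_norm g"
proof -
  have "((\<lambda>A. (sq_norm g)\<^sup>2 - (sq_norm (\<lambda>t. fourier_sum (fcoeff g) A t - g t))\<^sup>2)
      \<longlongrightarrow> (sq_norm g)\<^sup>2 - 0\<^sup>2) (finite_subsets_at_top UNIV)"
    by (intro tendsto_intros fourier_sum_fcoeff_tendsto g)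
  moreover have "\<forall>\<^sub>F A in finite_subsets_at_top UNIV.
      (sq_norm g)\<^sup>2 - (sq_norm (\<lambda>t. fourier_sum (fcoeff g) A t - g t))\<^sup>2 = (\<Sum>m\<in>A. (cmod (fcoeff g m))\<^sup>2)"
    by (rule eventually_finite_subsets_at_top_weakI) (simp add: Bessel_identity g)
  ultimately have "((\<lambda>m. (cmod (fcoeff g m))\<^sup>2) has_sum (sq_norm g)\<^sup>2) UNIV"
    unfolding has_sum_def by (simp add: filterlim_cong[OF refl refl])
  then show ?thesis
    unfolding l2_norm_def by (simp add: infsumI)
qed

section \<open>Equivalence classes and their representatives\<close>

lemma ae_rel_Image: "g \<in> sq_integrable \<Longrightarrow>
    ae_rel `` {g} = {h \<in> sq_integrable. AE t in circ_measure. g t = h t}"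
  by (auto simp: ae_rel_def)

text \<open>Limits of the Fourier series are unique only up to null sets, so together they fill a
  whole class. With \<open>fcoeff_surj_l2\<close> this reduces statements on
  \<open>fourier f\<close> to a representative.\<close>

lemma fourier_fcoeff:
  assumes g: "g \<in> sq_integrable"
  shows "fourier (fcoeff g) = ae_rel `` {g}"
  unfolding fourier_def ae_rel_Image[OF g]
proof (intro Collect_cong conj_cong refl)
  fix h assume h: "h \<in> sq_integrable"
  show "((\<lambda>A. sq_norm (\<lambda>t. fourier_sum (fcoeff g) A t - h t)) \<longlongrightarrow> 0) (finite_subsets_at_top UNIV)
    \<longleftrightarrow> (AE t in circ_measure. g t = h t)"
    using fcoeff_eq_if_fourier_sum_tendsto[OF h, of "fcoeff g"] fourier_sum_fcoeff_tendsto[OF h] fcoeff_eq_iff[OF g h]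
    by metis
qed

lemma L2_eq: "L2 = (\<lambda>g. ae_rel `` {g}) ` sq_integrable"
  by (auto simp: L2_def quotient_def)

lemma L2_norm_class:
  assumes g: "g \<in> sq_integrable"
  shows "L2_norm (ae_rel `` {g}) = sq_norm g"
proof -
  have "sq_norm h = sq_norm g" if "h \<in> ae_rel `` {g}" for h
    using that g unfolding ae_rel_Image[OF g]
    by (intro sq_norm_cong_AE) (auto intro: sq_integrable_measurable)
  moreover have "g \<in> ae_rel `` {g}"
    using g by (simp add: ae_rel_Image)
  ultimately have "sq_norm ` (ae_rel `` {g}) = {sq_norm g}"
    by blast
  then show ?thesis by (simp add: L2_norm_def)
qed

lemma inv_fourier_class:
  assumes g: "g \<in> sq_integrable"
  shows "inv_fourier (ae_rel `` {g}) = fcoeff g"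
proof
  fix m
  have "fcoeff h m = fcoeff g m" if "h \<in> ae_rel `` {g}" for h
    using that fcoeff_cong_AE[OF g, of h] by (simp add: ae_rel_Image[OF g])
  moreover have "g \<in> ae_rel `` {g}"
    using g by (simp add: ae_rel_Image)
  ultimately have "(\<lambda>h. fcoeff h m) ` (ae_rel `` {g}) = {fcoeff g m}"
    by blast
  then show "inv_fourier (ae_rel `` {g}) m = fcoeff g m"
    by (simp add: inv_fourier_def fcoeff_def)
qed

lemma measurable_indicator_circ:
  "A \<in> sets borel \<Longrightarrow> (indicator A :: real \<Rightarrow> complex) \<in> borel_measurable circ_measure"
  by (intro measurable_restrict_space1 borel_measurable_indicator) auto

lemma sq_integrable_indicator:
  "g \<in> sq_integrable \<Longrightarrow> (\<lambda>t. indicator {0..pi} t * g t) \<in> sq_integrable"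
  by (rule sq_integrable_mult_bounded[where B=1, OF _ measurable_indicator_circ])
    (simp_all add: indicator_def)

lemma chi_mult_class:
  assumes g: "g \<in> sq_integrable"
  shows "chi_mult (ae_rel `` {g}) = ae_rel `` {\<lambda>t. indicator {0..pi} t * g t}"
proof -
  let ?\<chi> = "\<lambda>h t. indicator {0..pi} t * h t :: complex"
  have "ae_rel `` {?\<chi> h} = ae_rel `` {?\<chi> g}" if "h \<in> ae_rel `` {g}" for h
  proof -
    have h: "h \<in> sq_integrable" "AE t in circ_measure. g t = h t"
      using that by (auto simp: ae_rel_Image[OF g])
    from h(2) have eq: "AE t in circ_measure. ?\<chi> g t = ?\<chi> h t"
      by eventually_elim simp
    have "(AE t in circ_measure. ?\<chi> h t = k t) \<longleftrightarrow> (AE t in circ_measure. ?\<chi> g t = k t)" for k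
      by (rule eventually_subst) (use eq in \<open>eventually_elim, auto\<close>)
    then show ?thesis
      unfolding ae_rel_Image[OF sq_integrable_indicator[OF h(1)]]
        ae_rel_Image[OF sq_integrable_indicator[OF g]] by simp
  qed
  moreover have "g \<in> ae_rel `` {g}"
    using g by (simp add: ae_rel_Image)
  ultimately show ?thesis
    unfolding chi_mult_def by blast
qed

definition vanishes_lower :: "(real \<Rightarrow> complex) \<Rightarrow> bool" where
  "vanishes_lower g \<longleftrightarrow> (AE t in circ_measure. t \<in> {-pi<..<0} \<longrightarrow> g t = 0)"

lemma supp_upper_class:
  assumes g: "g \<in> sq_integrable"
  shows "supp_upper (ae_rel `` {g}) \<longleftrightarrow> vanishes_lower g"
proof
  assume "supp_upper (ae_rel `` {g})"
  then show "vanishes_lower g"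
    using g by (auto simp: supp_upper_def ae_rel_Image vanishes_lower_def)
next
  assume van: "vanishes_lower g"
  show "supp_upper (ae_rel `` {g})"
    unfolding supp_upper_def
  proof
    fix h assume "h \<in> ae_rel `` {g}"
    then have "AE t in circ_measure. g t = h t"
      using g by (simp add: ae_rel_Image)
    with van show "AE t in circ_measure. t \<in> {-pi<..<0} \<longrightarrow> h t = 0"
      unfolding vanishes_lower_def by eventually_elim auto
  qed
qed

text \<open>The sets (-pi, 0) and [0, pi] miss only the point -pi of the domain, which is
  null.\<close>

lemma vanishes_lower_AE_indicator:
  assumes "vanishes_lower g"
  shows "AE t in circ_measure. indicator {0..pi} t * g t = g t"
  using assms[unfolded vanishes_lower_def] AE_circ_measure_neq[of "-pi"] AE_space[of circ_measure]
  by eventually_elim (auto simp: indicator_def)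

lemma vanishes_lower_indicator: "vanishes_lower (\<lambda>t. indicator {0..pi} t * g t)"
  unfolding vanishes_lower_def by (intro AE_I2) (auto simp: indicator_def)

lemma vanishes_lower_diff:
  assumes "vanishes_lower g" "vanishes_lower h"
  shows "vanishes_lower (\<lambda>t. g t - h t)"
  using assms[unfolded vanishes_lower_def] unfolding vanishes_lower_def
  by eventually_elim auto

subsection \<open>Boundary values of the Hardy space\<close>

lemma norm_power2_1_plus_i_cis: "(cmod (1 + \<i> * cis t))\<^sup>2 = 2 * (1 - sin t)"
  using sin_cos_squared_add[of t] unfolding cmod_power2 by (simp add: power2_diff)

lemma norm_power2_cis_plus_i: "(cmod (cis t + \<i>))\<^sup>2 = 2 * (1 + sin t)"
  using sin_cos_squared_add[of t] unfolding cmod_power2 by (simp add: power2_sum)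

lemma sq_integrable_mult_cis: "g \<in> sq_integrable \<Longrightarrow> (\<lambda>t. cis t * g t) \<in> sq_integrable"
  using sq_integrable_mult_bounded[of g cis 1] measurable_cis_lebesgue[of 1] by simp

text \<open>A shift of m is multiplication by \<open>cis t\<close>, so the lattice equation equates
  all Fourier coefficients of \<open>?a\<close> and \<open>?b\<close>, and uniqueness makes them
  equal almost everywhere. The relation is left undivided because \<open>cis t + \<i>\<close>
  vanishes at -pi/2.\<close>

lemma holomorphic_row_multiplier:
  assumes F: "discrete_holomorphic F"
    and g: "\<And>n. g n \<in> sq_integrable" and row: "\<And>n. fcoeff (g n) = row F n"
  shows "AE t in circ_measure. (1 - sin t) * (cmod (g n t))\<^sup>2 = (1 + sin t) * (cmod (g (Suc n) t))\<^sup>2"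
proof -
  have cisg: "(\<lambda>t. cis t * g n t) \<in> sq_integrable" for n
    by (rule sq_integrable_mult_cis[OF g])
  let ?a = "\<lambda>t. g n t + \<i> * (cis t * g n t)"
  let ?b = "\<lambda>t. cis t * g (Suc n) t + \<i> * g (Suc n) t"
  have ab: "?a \<in> sq_integrable" "?b \<in> sq_integrable"
    by (intro sq_integrable_add sq_integrable_cmult cisg g)+
  have "fcoeff ?a m = fcoeff ?b m" for m
  proof -
    have "fcoeff ?a m = F (m, n) + \<i> * F (m + 1, n)"
      by (simp add: fcoeff_add fcoeff_cmult fcoeff_mult_cis sq_integrable_cmult cisg g row row_def)
    also have "\<dots> = F (m + 1, Suc n) + \<i> * F (m, Suc n)"
      using F[unfolded discrete_holomorphic_def, rule_format, of m n] by (simp add: algebra_simps)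
    also have "\<dots> = fcoeff ?b m"
      by (simp add: fcoeff_add fcoeff_cmult fcoeff_mult_cis sq_integrable_cmult cisg g row row_def)
    finally show ?thesis .
  qed
  then have "AE t in circ_measure. ?a t = ?b t"
    using fcoeff_eq_iff[OF ab] by blast
  then show ?thesis
  proof eventually_elim
    case (elim t)
    then have "(1 + \<i> * cis t) * g n t = (cis t + \<i>) * g (Suc n) t"
      by (simp add: algebra_simps)
    then have "(cmod ((1 + \<i> * cis t) * g n t))\<^sup>2 = (cmod ((cis t + \<i>) * g (Suc n) t))\<^sup>2"
      by simp
    then show ?case
      unfolding norm_mult power_mult_distrib norm_power2_1_plus_i_cis norm_power2_cis_plus_i mult.assoc
      by (simp only: mult_cancel_left) simp
  qed
qed

text \<open>
  Where \<open>sin t < 0\<close> the multiplier has modulus greater than 1, so mass of \<open>g 0\<close> there would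
  make the norms of the \<open>g n\<close> grow without bound.
\<close>

lemma vanishes_lower_if_bounded:
  assumes g: "\<And>n. g n \<in> sq_integrable"
    and rel: "\<And>n. AE t in circ_measure. (1 - sin t) * (cmod (g n t))\<^sup>2 = (1 + sin t) * (cmod (g (Suc n) t))\<^sup>2"
    and B: "\<And>n. sq_norm (g n) \<le> B"
  shows "vanishes_lower (g 0)"
proof -
  \<comment> \<open>The factor - sin t is the slope in Bernoulli's bound. It is at most 1, which
    makes \<open>w\<close> integrable, and positive on (-pi, 0), so that \<open>w t = 0\<close>
    forces \<open>g 0 t = 0\<close> there.\<close>
  define w where "w t = indicator {-pi<..<0} t * - sin t * (cmod (g 0 t))\<^sup>2" for t :: real
  have w_le: "0 \<le> w t" "w t \<le> (cmod (g 0 t))\<^sup>2" if "t \<in> {-pi..pi}" for t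
  proof -
    have c: "0 \<le> indicator {-pi<..<0} t * - sin t" "indicator {-pi<..<0} t * - sin t \<le> 1"
      using sin_gt_zero[of "- t"] sin_ge_minus_one[of t] by (auto simp: indicator_def)
    show "0 \<le> w t"
      unfolding w_def by (rule mult_nonneg_nonneg[OF c(1)]) simp
    show "w t \<le> (cmod (g 0 t))\<^sup>2"
      unfolding w_def by (rule mult_left_le_one_le[OF _ c]) simp
  qed
  have [measurable]: "w \<in> borel_measurable circ_measure"
  proof -
    have "(\<lambda>t. indicator {-pi<..<0} t * - sin t :: real) \<in> borel_measurable circ_measure"
      by (intro measurable_restrict_space1 measurable_completion) measurable
    then show ?thesis
      unfolding w_def[abs_def] using sq_integrable_measurable[OF g] by measurable
  qed
  have w_int: "integrable circ_measure w"
  proof (rule Bochner_Integration.integrable_bound[OF sq_integrable_integrable_sq[OF g[of 0]]])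
    show "AE t in circ_measure. norm (w t) \<le> norm ((cmod (g 0 t))\<^sup>2)"
      using w_le by (intro AE_I2) auto
  qed measurable
  let ?I = "LINT t|circ_measure. w t"
  \<comment> \<open>One exceptional null set serves all n, as the induction over rows at a fixed t
    requires.\<close>
  have all: "AE t in circ_measure. \<forall>n. (1 - sin t) * (cmod (g n t))\<^sup>2 = (1 + sin t) * (cmod (g (Suc n) t))\<^sup>2"
    using rel by (simp add: AE_all_countable)
  have bound: "of_nat n * ?I \<le> B\<^sup>2" for n
  proof -
    have "AE t in circ_measure. of_nat n * w t \<le> (cmod (g n t))\<^sup>2"
      using all AE_space
    proof eventually_elim
      case (elim t)
      show ?case
      proof (cases "t \<in> {-pi<..<0}")
        case True
        have s: "sin t < 0" "-1 \<le> sin t"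
          using True sin_gt_zero[of "- t"] by auto
        have "(1 - sin t) ^ k * (cmod (g 0 t))\<^sup>2 \<le> (cmod (g k t))\<^sup>2" for k
        proof (induction k)
          case (Suc k)
          have "(1 - sin t) ^ Suc k * (cmod (g 0 t))\<^sup>2 \<le> (1 - sin t) * (cmod (g k t))\<^sup>2"
            using Suc s by (simp add: mult.assoc mult_left_mono)
          also have "\<dots> = (1 + sin t) * (cmod (g (Suc k) t))\<^sup>2"
            using elim by blast
          also have "\<dots> \<le> 1 * (cmod (g (Suc k) t))\<^sup>2"
            using s by (intro mult_right_mono) auto
          finally show ?case by simp
        qed simp
        note this[of n]
        moreover have "of_nat n * - sin t \<le> (1 - sin t) ^ n"
          using Bernoulli_inequality[of "- sin t" n] s by simp
        then have "of_nat n * - sin t * (cmod (g 0 t))\<^sup>2 \<le> (1 - sin t) ^ n * (cmod (g 0 t))\<^sup>2"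
          by (intro mult_right_mono) auto
        ultimately show ?thesis
          using True by (simp add: w_def mult.assoc)
      qed (simp add: w_def)
    qed
    then have "(LINT t|circ_measure. of_nat n * w t) \<le> (LINT t|circ_measure. (cmod (g n t))\<^sup>2)"
      using w_int sq_integrable_integrable_sq[OF g[of n]] by (intro integral_mono_AE) auto
    also have "\<dots> \<le> B\<^sup>2"
      unfolding sq_norm_power2[symmetric] using B by (intro power_mono) auto
    finally show ?thesis by simp
  qed
  have w_nonneg: "AE t in circ_measure. 0 \<le> w t"
    using w_le by (intro AE_I2) auto
  have "?I \<le> 0"
  proof (rule ccontr)
    assume "\<not> ?I \<le> 0"
    then obtain n :: nat where "B\<^sup>2 < of_nat n * ?I"
      using reals_Archimedean3[of ?I] by (auto simp: not_le)
    with bound[of n] show False by simp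
  qed
  moreover have "?I \<ge> 0"
    using w_nonneg by (rule integral_nonneg_AE)
  ultimately have "AE t in circ_measure. w t = 0"
    using integral_nonneg_eq_0_iff_AE[OF w_int w_nonneg] by simp
  then show ?thesis
    unfolding vanishes_lower_def
  proof eventually_elim
    case (elim t)
    show ?case
    proof
      assume t: "t \<in> {-pi<..<0}"
      then have "sin t < 0" using sin_gt_zero[of "- t"] by auto
      with elim t show "g 0 t = 0" by (simp add: w_def)
    qed
  qed
qed

lemma H2_boundary:
  assumes F: "F \<in> H2"
  obtains g where "g \<in> sq_integrable" "vanishes_lower g" "fcoeff g = J F" "H2_norm F = sq_norm g"
proof -
  have hol: "discrete_holomorphic F" and rows: "\<And>n. row F n \<in> l2"
    and bdd: "bdd_above (range (\<lambda>n. l2_norm (row F n)))"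
    using F by (auto simp: H2_def)
  have "\<exists>g. g \<in> sq_integrable \<and> fcoeff g = row F n" for n
    using fcoeff_surj_l2[OF rows] by metis
  then obtain g where g: "\<And>n. g n \<in> sq_integrable" and row: "\<And>n. fcoeff (g n) = row F n"
    by metis
  note rel = holomorphic_row_multiplier[OF hol g row]
  have norm: "l2_norm (row F n) = sq_norm (g n)" for n
    using Parseval_norm[OF g[of n]] by (simp add: row)
  obtain B where B: "\<And>n. sq_norm (g n) \<le> B"
    using bdd by (auto simp: bdd_above_def norm)
  \<comment> \<open>The rows from n upwards satisfy the same relations with the same bound, so the
    argument for the bottom row applies to every row.\<close>
  have van: "vanishes_lower (g n)" for n
    using vanishes_lower_if_bounded[of "\<lambda>k. g (n + k)", OF g _ B] rel by simp
  have decr: "sq_norm (g (Suc n)) \<le> sq_norm (g n)" for n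
  proof -
    have "AE t in circ_measure. (cmod (g (Suc n) t))\<^sup>2 \<le> (cmod (g n t))\<^sup>2"
      using rel[of n] van[of "Suc n", unfolded vanishes_lower_def]
        AE_circ_measure_neq[of "-pi"] AE_space[of circ_measure]
    proof eventually_elim
      case (elim t)
      show ?case
      \<comment> \<open>For t < 0 the relation points the wrong way; the inequality holds there
        because \<open>g (Suc n) t\<close> is 0.\<close>
      proof (cases "t < 0")
        case True
        then show ?thesis using elim by simp
      next
        case False
        then have s: "0 \<le> sin t"
          using elim by (intro sin_ge_zero) auto
        then have "(cmod (g (Suc n) t))\<^sup>2 \<le> (1 + sin t) * (cmod (g (Suc n) t))\<^sup>2"
          by (simp add: distrib_right)
        also have "\<dots> = (1 - sin t) * (cmod (g n t))\<^sup>2"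
          using elim by simp
        also have "\<dots> \<le> (cmod (g n t))\<^sup>2"
          using s by (simp add: left_diff_distrib)
        finally show ?thesis .
      qed
    qed
    then have "(sq_norm (g (Suc n)))\<^sup>2 \<le> (sq_norm (g n))\<^sup>2"
      unfolding sq_norm_power2 by (intro integral_mono_AE sq_integrable_integrable_sq g)
    then show ?thesis
      by (rule power2_le_imp_le) simp
  qed
  have "sq_norm (g n) \<le> sq_norm (g 0)" for n
    by (induction n) (auto intro: order_trans decr)
  then have "H2_norm F = sq_norm (g 0)"
    unfolding H2_norm_def norm by (intro cSup_eq_maximum) auto
  with g[of 0] van[of 0] row[of 0] show thesis
    by (intro that[of "g 0"]) (auto simp: row_def J_def)
qed

lemma H2_extension:
  assumes g: "g \<in> sq_integrable" and van: "vanishes_lower g"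
  shows "fcoeff g \<in> J ` H2"
proof -
  \<comment> \<open>The value 0 off [0, pi] avoids the zero of the denominator at -pi/2 and lets the
    bound |\<mu>| \<le> 1 hold at every t, as \<open>sq_integrable_mult_bounded\<close>
    asks.\<close>
  define \<mu> where "\<mu> t = (if t \<in> {0..pi} then (1 + \<i> * cis t) / (cis t + \<i>) else 0)" for t
  \<comment> \<open>The separate indicator matters for n = 0, where \<open>\<mu> t ^ 0\<close> is 1
    also off [0, pi]: with it the recurrence from \<open>G n\<close> to \<open>G (Suc n)\<close>
    holds at every t, while \<open>G 0\<close> still equals g almost everywhere.\<close>
  define G where "G n t = \<mu> t ^ n * (indicator {0..pi} t * g t)" for n t
  define F where "F = (\<lambda>(m, n). fcoeff (G n) m)"
  have nz: "cis t + \<i> \<noteq> 0" if "t \<in> {0..pi}" for t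
  proof -
    have "sin t \<ge> 0" using that by (intro sin_ge_zero) auto
    then have "(cmod (cis t + \<i>))\<^sup>2 > 0"
      by (simp add: norm_power2_cis_plus_i)
    then show ?thesis by auto
  qed
  have \<mu>_le: "cmod (\<mu> t) \<le> 1" for t
  proof (cases "t \<in> {0..pi}")
    case True
    then have "sin t \<ge> 0" by (intro sin_ge_zero) auto
    then have "(cmod (1 + \<i> * cis t))\<^sup>2 \<le> (cmod (cis t + \<i>))\<^sup>2"
      unfolding norm_power2_1_plus_i_cis norm_power2_cis_plus_i by simp
    then have "cmod (1 + \<i> * cis t) \<le> cmod (cis t + \<i>)"
      by (rule power2_le_imp_le) simp
    then show ?thesis
      using True nz[OF True] by (simp add: \<mu>_def norm_divide divide_le_eq_1)
  qed (auto simp: \<mu>_def)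
  have [measurable]: "\<mu> \<in> borel_measurable circ_measure"
  proof -
    have "(\<lambda>t. (1 + \<i> * cis t) / (cis t + \<i>)) \<in> borel_measurable circ_measure"
      using measurable_cis_lebesgue[of 1] by simp
    then have "(\<lambda>t. indicator {0..pi} t * ((1 + \<i> * cis t) / (cis t + \<i>))) \<in> borel_measurable circ_measure"
      by (intro borel_measurable_times measurable_indicator_circ) auto
    moreover have "\<mu> = (\<lambda>t. indicator {0..pi} t * ((1 + \<i> * cis t) / (cis t + \<i>)))"
      by (auto simp: \<mu>_def indicator_def)
    ultimately show ?thesis by simp
  qed
  have G: "G n \<in> sq_integrable" for n
    unfolding G_def[abs_def]
  proof (rule sq_integrable_mult_bounded[where B=1])
    show "(\<lambda>t. indicator {0..pi} t * g t) \<in> sq_integrable"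
      by (rule sq_integrable_indicator[OF g])
    show "cmod (\<mu> t ^ n) \<le> 1" for t
      using \<mu>_le by (simp add: norm_power power_le_one)
  qed measurable
  have norm_G: "sq_norm (G n) \<le> sq_norm g" for n
  proof -
    have "(sq_norm (G n))\<^sup>2 \<le> (sq_norm g)\<^sup>2"
      unfolding sq_norm_power2
    proof (intro integral_mono sq_integrable_integrable_sq G g power_mono)
      fix t
      have "cmod (\<mu> t) ^ n \<le> 1"
        using \<mu>_le by (intro power_le_one) auto
      then have "cmod (\<mu> t) ^ n * cmod (indicator {0..pi} t * g t) \<le> 1 * cmod (g t)"
        by (intro mult_mono) (auto simp: indicator_def)
      then show "cmod (G n t) \<le> cmod (g t)"
        by (simp add: G_def norm_mult norm_power)
    qed auto
    then show ?thesis
      by (rule power2_le_imp_le) simp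
  qed
  have cisG: "(\<lambda>t. cis t * G n t) \<in> sq_integrable" for n
    by (rule sq_integrable_mult_cis[OF G])
  have "F (m, n) + \<i> * F (m + 1, n) = F (m + 1, Suc n) + \<i> * F (m, Suc n)" for m n
  proof -
    have "(1 + \<i> * cis t) * G n t = (cis t + \<i>) * G (Suc n) t" for t
      using nz[of t] by (cases "t \<in> {0..pi}") (simp_all add: G_def \<mu>_def)
    then have eq: "(\<lambda>t. G n t + \<i> * (cis t * G n t)) = (\<lambda>t. cis t * G (Suc n) t + \<i> * G (Suc n) t)"
      by (auto simp: distrib_right mult.assoc)
    have "F (m, n) + \<i> * F (m + 1, n) = fcoeff (\<lambda>t. G n t + \<i> * (cis t * G n t)) m"
      by (simp add: F_def fcoeff_add fcoeff_cmult fcoeff_mult_cis sq_integrable_cmult cisG G)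
    also have "\<dots> = F (m + 1, Suc n) + \<i> * F (m, Suc n)"
      unfolding eq by (simp add: F_def fcoeff_add fcoeff_cmult fcoeff_mult_cis sq_integrable_cmult cisG G)
    finally show ?thesis .
  qed
  then have "discrete_holomorphic F"
    unfolding discrete_holomorphic_def by (simp add: diff_diff_eq)
  moreover have row: "row F n = fcoeff (G n)" for n
    by (simp add: row_def F_def)
  then have "row F n \<in> l2" for n
    by (simp add: fcoeff_in_l2 G)
  moreover have "bdd_above (range (\<lambda>n. l2_norm (row F n)))"
    using norm_G by (intro bdd_aboveI2[of _ _ "sq_norm g"]) (simp add: row Parseval_norm G)
  ultimately have "F \<in> H2"
    by (simp add: H2_def)
  moreover have "J F = fcoeff (G 0)"
    by (simp add: J_def F_def)
  moreover have "fcoeff (G 0) = fcoeff g"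
    using vanishes_lower_AE_indicator[OF van] by (intro fcoeff_cong_AE G g) (simp add: G_def)
  ultimately show ?thesis
    by force
qed

lemma J_image_H2: "J ` H2 = fcoeff ` {g \<in> sq_integrable. vanishes_lower g}"
proof
  show "J ` H2 \<subseteq> fcoeff ` {g \<in> sq_integrable. vanishes_lower g}"
  proof
    fix a assume "a \<in> J ` H2"
    then obtain F where "F \<in> H2" "a = J F" by auto
    then show "a \<in> fcoeff ` {g \<in> sq_integrable. vanishes_lower g}"
      using H2_boundary[of F] by (metis (mono_tags, lifting) imageI mem_Collect_eq)
  qed
qed (use H2_extension in auto)

section \<open>The Szego projection\<close>

lemma orth_proj_fcoeff:
  assumes g: "g \<in> sq_integrable"
  shows "orth_proj (J ` H2) (fcoeff g) = fcoeff (\<lambda>t. indicator {0..pi} t * g t)"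
  unfolding orth_proj_def
proof (rule the_equality)
  let ?p = "\<lambda>t. indicator {0..pi} t * g t"
  have p: "?p \<in> sq_integrable"
    by (rule sq_integrable_indicator[OF g])
  have diff: "l2_inner (\<lambda>m. fcoeff g m - fcoeff k m) (fcoeff u) = circ_inner (\<lambda>t. g t - k t) u"
    if k: "k \<in> sq_integrable" and u: "u \<in> sq_integrable" for k u
  proof -
    have "(\<lambda>m. fcoeff g m - fcoeff k m) = fcoeff (\<lambda>t. g t - k t)"
      by (simp add: fun_eq_iff fcoeff_diff g k)
    then show ?thesis
      using Parseval_inner[OF sq_integrable_diff[OF g k] u] by simp
  qed
  \<comment> \<open>Off [0, pi] the function u vanishes almost everywhere, and on [0, pi] the
    difference g - \<open>?p\<close> is 0.\<close>
  have orth: "circ_inner (\<lambda>t. g t - ?p t) u = 0" if u: "vanishes_lower u" for u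
    unfolding circ_inner_def
  proof (rule integral_eq_zero_AE)
    show "AE t in circ_measure. (g t - ?p t) * cnj (u t) = 0"
      using vanishes_lower_AE_indicator[OF u]
      by eventually_elim (auto simp: indicator_def split: if_splits)
  qed
  show "fcoeff ?p \<in> J ` H2 \<and> (\<forall>h\<in>J ` H2. l2_inner (\<lambda>m. fcoeff g m - fcoeff ?p m) h = 0)"
    using p diff[OF p] orth vanishes_lower_indicator[of g] unfolding J_image_H2 by auto
  fix a assume a: "a \<in> J ` H2 \<and> (\<forall>h\<in>J ` H2. l2_inner (\<lambda>m. fcoeff g m - a m) h = 0)"
  then obtain k where k: "k \<in> sq_integrable" "vanishes_lower k" "a = fcoeff k"
    unfolding J_image_H2 by auto
  \<comment> \<open>The difference of the two candidates lies in the subspace, and both g - k and g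
    - \<open>?p\<close> are orthogonal to it; subtracting shows that \<open>?u\<close> is orthogonal
    to itself. The definite description in \<open>orth_proj\<close> calls for this
    uniqueness.\<close>
  let ?u = "\<lambda>t. ?p t - k t"
  have u: "?u \<in> sq_integrable" "vanishes_lower ?u"
    using p k vanishes_lower_indicator[of g] by (auto intro: sq_integrable_diff vanishes_lower_diff)
  have "l2_inner (\<lambda>m. fcoeff g m - fcoeff k m) (fcoeff ?u) = 0"
    using a u unfolding J_image_H2 k(3) by blast
  then have "circ_inner (\<lambda>t. g t - k t) ?u = 0"
    unfolding diff[OF k(1) u(1)] .
  moreover have "circ_inner ?u ?u = circ_inner (\<lambda>t. g t - k t) ?u - circ_inner (\<lambda>t. g t - ?p t) ?u"
    using circ_inner_diff_left[OF sq_integrable_diff[OF g k(1)] sq_integrable_diff[OF g p] u(1)] by simp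
  ultimately have "sq_norm ?u = 0"
    using orth[OF u(2)] by (simp add: circ_inner_self)
  then have "AE t in circ_measure. k t = ?p t"
    unfolding sq_norm_eq_0_iff[OF u(1)] by eventually_elim simp
  then show "a = fcoeff ?p"
    using fcoeff_cong_AE[OF k(1) p] k(3) by simp
qed

lemma cauchy_kernel_eq:
  "cauchy_kernel m = 1 / (2 * pi) * (LINT t|circ_measure. indicator {0..pi} t * cis (of_int m * t))"
proof -
  have "(LINT t|lebesgue_on {0..pi}. cis (of_int m * t)) =
      (LINT t|circ_measure. (if t \<in> {0..pi} then cis (of_int m * t) else 0))"
    by (intro integral_restrict[symmetric]) auto
  also have "\<dots> = (LINT t|circ_measure. indicator {0..pi} t * cis (of_int m * t))"
    by (intro Bochner_Integration.integral_cong refl) (auto simp: indicator_def)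
  finally show ?thesis
    by (simp add: cauchy_kernel_def)
qed

text \<open>
  The \<open>m\<close>-th entry of the convolution is the inner product of \<open>g\<close> with
  \<open>\<chi>\<close> times the \<open>m\<close>-th exponential, whose coefficients are conjugated Cauchy kernels.
\<close>

lemma conv_cauchy_kernel:
  assumes g: "g \<in> sq_integrable"
  shows "conv (fcoeff g) cauchy_kernel = fcoeff (\<lambda>t. indicator {0..pi} t * g t)"
proof
  fix m
  \<comment> \<open>The frequency is -m because \<open>circ_inner\<close> conjugates its second
    argument. One factor 1/sqrt(2 pi) here and one in \<open>fcoeff\<close> make up the 1/(2 pi) of
    the Cauchy kernel, and \<open>Parseval_inner\<close> takes the place of an interchange of sum
    and integral.\<close>
  define k where "k t = 1 / sqrt (2 * pi) * (indicator {0..pi} t * cis (of_int (- m) * t))" for t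
  have k: "k \<in> sq_integrable"
    unfolding k_def[abs_def] by (intro sq_integrable_cmult sq_integrable_indicator sq_integrable_cis)
  have "cnj (fcoeff k j) = cauchy_kernel (m - j)" for j
  proof -
    have "fcoeff k j = 1 / sqrt (2 * pi) * (LINT t|circ_measure. 1 / sqrt (2 * pi) * cnj (indicator {0..pi} t * cis (of_int (m - j) * t)))"
      unfolding fcoeff_def k_def mult.assoc
      by (intro arg_cong2[where f="(*)"] refl Bochner_Integration.integral_cong)
        (simp add: indicator_def cis_cnj cis_mult algebra_simps)
    also have "\<dots> = cnj (cauchy_kernel (m - j))"
      unfolding cauchy_kernel_eq Bochner_Integration.integral_mult_right_zero Bochner_Integration.integral_cnj
      by (simp flip: of_real_mult add: mult.assoc[symmetric])
    finally show ?thesis by simp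
  qed
  then have "conv (fcoeff g) cauchy_kernel m = l2_inner (fcoeff g) (fcoeff k)"
    by (simp add: conv_def l2_inner_def)
  also have "\<dots> = circ_inner g k"
    by (rule Parseval_inner[OF g k])
  also have "\<dots> = (LINT t|circ_measure. 1 / sqrt (2 * pi) * (indicator {0..pi} t * g t * cis (of_int m * t)))"
    unfolding circ_inner_def k_def
    by (intro Bochner_Integration.integral_cong refl) (simp add: indicator_def cis_cnj)
  also have "\<dots> = fcoeff (\<lambda>t. indicator {0..pi} t * g t) m"
    unfolding fcoeff_def by (rule Bochner_Integration.integral_mult_right_zero)
  finally show "conv (fcoeff g) cauchy_kernel m = fcoeff (\<lambda>t. indicator {0..pi} t * g t) m" .
qed

theorem theorem4p1:
  shows "fourier ` (J ` H2) = {G \<in> L2. supp_upper G} \<and>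
         (\<forall>f\<in>H2. L2_norm (fourier (J f)) = H2_norm f) \<and>
         (\<forall>f\<in>l2. orth_proj (J ` H2) f = conv f cauchy_kernel \<and>
                 conv f cauchy_kernel = inv_fourier (chi_mult (fourier f)))"
proof (intro conjI ballI)
  have "fourier ` (J ` H2) = (\<lambda>g. ae_rel `` {g}) ` {g \<in> sq_integrable. vanishes_lower g}"
    unfolding J_image_H2 image_image by (intro image_cong refl fourier_fcoeff) simp
  also have "\<dots> = {G \<in> L2. supp_upper G}"
    unfolding L2_eq using supp_upper_class by auto
  finally show "fourier ` (J ` H2) = {G \<in> L2. supp_upper G}" .
next
  fix f assume "f \<in> H2"
  then obtain g where "g \<in> sq_integrable" "fcoeff g = J f" "H2_norm f = sq_norm g"
    by (rule H2_boundary)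
  then show "L2_norm (fourier (J f)) = H2_norm f"
    using fourier_fcoeff[of g] L2_norm_class[of g] by simp
next
  fix f assume "f \<in> l2"
  then obtain g where g: "g \<in> sq_integrable" "fcoeff g = f"
    by (rule fcoeff_surj_l2)
  show "orth_proj (J ` H2) f = conv f cauchy_kernel"
    using orth_proj_fcoeff[OF g(1)] conv_cauchy_kernel[OF g(1)] by (simp add: g(2))
  show "conv f cauchy_kernel = inv_fourier (chi_mult (fourier f))"
    using conv_cauchy_kernel[OF g(1)] fourier_fcoeff[OF g(1)] chi_mult_class[OF g(1)]
      inv_fourier_class[OF sq_integrable_indicator[OF g(1)]] by (simp add: g(2))
qed

end
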